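(* Let $\Psi$ be a rigid complement map on $V^*$. For every $\Psi$-generic lattice polytope $P$ in $V$ and every polynomial function $h(x)$ on $V$, $$\int_P h(x)=\sum_{F\in\mathcal F(P)}\ \sum_{x\in F\cap\Lambda}\left(\Delta^{\Psi}(P,F)\cdot h\right)(x),$$ where $\Delta^\Psi(P,F)=\lambda^{\Psi}(\mathrm{Supp}(P,F))(\partial_x)$ is the infinite-order constant-coefficient differential operator obtained from the Taylor series of $\lambda^\Psi(\mathrm{Supp}(P,F))$ at $\xi=0$. In particular, for $h=1$, $$\mathrm{vol}(P)=\sum_{F\in\mathcal F(P)}\lambda^\Psi(\mathrm{Supp}(P,F))(0)\,\#(F),$$ where $\#(F)$ denotes the number of lattice points of $F$.
   Context: Basic setting. $\Lambda\cong\mathbb Z^n$ is a lattice, $V=\Lambda\otimes_{\mathbb Z}\mathbb Q$, $V^*=\mathrm{Hom}_{\mathbb Q}(V,\mathbb Q)$ with pairing $\langle\cdot,\cdot\rangle$. $\mathcal M(V^* )$ is the algebra of meromorphic functions on $V^*_{\mathbb C}=V^*\otimes\mathbb C$. A rational quotient $W$ of $V$ carries the image lattice, and $W^*$ is regarded as a subspace of $V^*$. Polyhedra are nonempty subsets of $V$ cut out by finitely many affine inequalities with rational coefficients; a polytope is a bounded polyhedron; a cone is a polyhedron $s+C$ with $s\in V$ and $C$ a rational polyhedral convex cone with apex $0$. A lattice cone is a cone whose largest affine subspace contains a point of $\Lambda$; a lattice polyhedron (polytope) is one whose vertices lie in $\Lambda$ (if it has no vertices: whose minimal faces contain points of $\Lambda$).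 $\mathcal F(P)$ is the set of nonempty faces of $P$ (including $P$). $\mathrm{lin}(F)$ is the linear subspace parallel to the affine span $\mathrm{aff}(F)$. For a face $F$ of $P$ and $x$ in the relative interior of $F$, $\mathrm{Tan}(P,F)=\{v\in V: x+\epsilon v\in P\text{ for small }\epsilon>0\}$ and $\mathrm{Supp}(P,F)=x+\mathrm{Tan}(P,F)$. Integrals and volumes over $P$ are over the corresponding real polyhedron, with respect to Lebesgue measure on $\mathrm{aff}(P)$ normalized so that a basis of $\Lambda\cap \mathrm{lin}(P)$ spans a parallelepiped of volume $1$ (unit mass for a point). Exponential sums and integrals. For a polyhedron $P$, $S(P),I(P)\in\mathcal M(V^* )$ are the functions (which exist by a theorem of Lawrence) determined by: $S(P)=I(P)=0$ if $P$ contains a line; otherwise $S(P)(\xi)=\sum_{x\in P\cap\Lambda}e^{\langle\xi,x\rangle}$ and $I(P)(\xi)=\int_P e^{\langle\xi,x\rangle}dx$ for all $\xi$ for which the sum (resp. integral) converges absolutely. Rigid complement maps. A rigid complement map $\Psi$ on $V^*$ is a map from a collection $\mathcal L^\Psi$ of linear subspaces of $V^*$ to the set of linear subspaces of $V^*$ such that (a) $V^*=U\oplus\Psi(U)$ for $U\in\mathcal L^\Psi$; (b) if $U_1\subset U_2$ are in $\mathcal L^\Psi$ then $\Psi(U_2)\subset\Psi(U_1)$. Genericity. A quotient $W$ of $V$ is $\Psi$-generic if $W^*\in\mathcal L^\Psi$; a subspace $U\subset V$ is $\Psi$-generic if $V/U$ is; a cone $K$ is $\Psi$-generic if $\mathrm{lin}(F)$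 is $\Psi$-generic for every face $F$ of $K$; a polyhedron $P$ is $\Psi$-generic if every $\mathrm{Supp}(P,F)$ is. If $W$ is a $\Psi$-generic quotient, $\bar\Psi$ denotes the induced complement map on $W^*$: $\bar\Psi(U)=\Psi(U)\cap W^*$ for $U\in\mathcal L^\Psi$, $U\subset W^*$ with $\Psi(U)\cap W^*$ complementary to $U$ in $W^*$; and $\pi_W:V^*\to W^*$ is the projection with kernel $\Psi(W^* )$. Compatible IS-interpolators. A $\Psi$-compatible $\mathrm{IS}$-interpolator is a map $\lambda$ from the $\Psi$-generic lattice cones of $V$ to $\mathcal M(V^* )$ such that (i) $I(P)=\sum_{F\in\mathcal F(P)}\lambda(\mathrm{Supp}(P,F))\,S(F)$ for all $\Psi$-generic lattice polyhedra $P$ in $V$; (ii) for every $\Psi$-generic quotient $q:V\to W$, the map $\bar\lambda(K)=\lambda(q^{-1}(K))|_{W^*}$ on $\bar\Psi$-generic lattice cones of $W$ satisfies the same identity for all $\bar\Psi$-generic lattice polyhedra in $W$; (iii) $\lambda(q^{-1}(K))=\bar\lambda(K)\circ\pi_W$ for all such $W$ and $K$. There is a unique such map, denoted $\lambda^\Psi$, and its values are analytic at $\xi=0$. For $f(\xi)=\sum_\alpha a_\alpha\xi^\alpha$ (Taylor series in linear coordinates on $V^*$), $f(\partial_x)=\sum_\alpha a_\alpha\partial_x^\alpha$ in the dual coordinates on $V$. *)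

theory Defs
  imports "HOL-Analysis.Analysis"
begin

text \<open>
  Coordinates: \<open>\<Lambda> = \<int>\<^sup>n\<close> and \<open>V = \<rat>\<^sup>n\<close> is the type \<open>rat ^ 'n\<close>; the dual \<open>V\<^sup>*\<close> is again \<open>rat ^ 'n\<close>, the
  pairing being the standard bilinear form.

  A quotient \<open>q : V \<rightarrow> W\<close> is given by a square rational matrix \<open>Q\<close>: the space \<open>W\<close> is the range of
  \<open>x \<mapsto> Q x\<close>, with lattice \<open>Q \<Lambda>\<close>.  Up to isomorphism every rational quotient of \<open>V\<close> arises this way,
  because \<open>dim W \<le> dim V\<close>.  The space \<open>V\<close> itself is the case \<open>Q = mat 1\<close>.  Notions that are needed
  both in \<open>V\<close> and in its quotients take \<open>Q\<close> as their first argument.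
\<close>

definition pair :: "'a::comm_ring_1 ^ 'n \<Rightarrow> 'a ^ 'n \<Rightarrow> 'a" where
  "pair \<xi> x = (\<Sum>i\<in>UNIV. \<xi> $ i * x $ i)"

definition emb :: "rat ^ 'n \<Rightarrow> 'a::field_char_0 ^ 'n" where
  "emb x = (\<chi> i. of_rat (x $ i))"

definition emb_mat :: "rat ^ 'n ^ 'm \<Rightarrow> 'a::field_char_0 ^ 'n ^ 'm" where
  "emb_mat Q = (\<chi> i j. of_rat (Q $ i $ j))"

definition cvec :: "real ^ 'n \<Rightarrow> complex ^ 'n" where
  "cvec x = (\<chi> i. complex_of_real (x $ i))"

definition complexify :: "(rat ^ 'n) set \<Rightarrow> (complex ^ 'n) set" where
  "complexify U = vec.span (emb ` U)"

definition int_lattice :: "(rat ^ 'n) set" where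
  "int_lattice = {x. \<forall>i. x $ i \<in> \<int>}"

definition quot_space :: "rat ^ 'n ^ 'n \<Rightarrow> (rat ^ 'n) set" where
  "quot_space Q = range ((*v) Q)"

definition quot_lattice :: "rat ^ 'n ^ 'n \<Rightarrow> (rat ^ 'n) set" where
  "quot_lattice Q = (*v) Q ` int_lattice"

text \<open>\<open>quot_dual Q U\<close> is \<open>(W/U)\<^sup>*\<close> for a subspace \<open>U\<close> of \<open>W\<close>, as a subspace of \<open>V\<^sup>*\<close>: the functionals on
  \<open>V\<close> that vanish on the kernel of \<open>V \<rightarrow> W \<rightarrow> W/U\<close>.  In particular \<open>W\<^sup>*\<close> is \<open>quot_dual Q {0}\<close>.\<close>

definition quot_dual :: "rat ^ 'n ^ 'n \<Rightarrow> (rat ^ 'n) set \<Rightarrow> (rat ^ 'n) set" where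
  "quot_dual Q U = {\<xi>. \<forall>x. Q *v x \<in> U \<longrightarrow> pair \<xi> x = 0}"

definition quot_cdual :: "rat ^ 'n ^ 'n \<Rightarrow> (complex ^ 'n) set" where
  "quot_cdual Q = complexify (quot_dual Q {0})"

text \<open>The pairing of \<open>\<xi> \<in> W\<^sup>*\<^sub>\<complex> \<subseteq> V\<^sup>*\<^sub>\<complex>\<close> with \<open>y \<in> W\<^sub>\<complex>\<close>: evaluate \<open>\<xi>\<close> at any preimage of \<open>y\<close> in \<open>V\<^sub>\<complex>\<close>; the choice
  does not matter.  For \<open>Q = mat 1\<close> this is \<open>pair \<xi> y\<close>.\<close>

definition quot_pair :: "rat ^ 'n ^ 'n \<Rightarrow> complex ^ 'n \<Rightarrow> complex ^ 'n \<Rightarrow> complex" where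
  "quot_pair Q \<xi> y = pair \<xi> (SOME x. emb_mat Q *v x = y)"

definition polyhedron_in :: "rat ^ 'n ^ 'n \<Rightarrow> (rat ^ 'n) set \<Rightarrow> bool" where
  "polyhedron_in Q P \<longleftrightarrow> P \<noteq> {} \<and>
     (\<exists>A. finite A \<and> P = {x \<in> quot_space Q. \<forall>(a, b)\<in>A. pair a x \<le> b})"

definition bounded_rat :: "(rat ^ 'n) set \<Rightarrow> bool" where
  "bounded_rat P \<longleftrightarrow> (\<exists>B. \<forall>x\<in>P. \<forall>i. \<bar>x $ i\<bar> \<le> B)"

definition faces :: "(rat ^ 'n) set \<Rightarrow> (rat ^ 'n) set set" where
  "faces P = {F. F \<noteq> {} \<and> (\<exists>a b. (\<forall>x\<in>P. pair a x \<le> b) \<and> F = {x \<in> P. pair a x = b})}"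

definition lin :: "(rat ^ 'n) set \<Rightarrow> (rat ^ 'n) set" where
  "lin F = vec.span {x - y |x y. x \<in> F \<and> y \<in> F}"

definition rel_int :: "(rat ^ 'n) set \<Rightarrow> (rat ^ 'n) set" where
  "rel_int F = {x \<in> F. \<forall>y\<in>F. \<exists>e>0. x + e *s (x - y) \<in> F}"

text \<open>The tangent cone at a point; it is the same for all points of the relative interior of a
  face \<open>F\<close>, and so is \<open>x + tan_at P x\<close>, whence \<open>supp_cone P F\<close> is \<open>x + Tan(P, F)\<close> for
  each such \<open>x\<close>.\<close>

definition tan_at :: "(rat ^ 'n) set \<Rightarrow> rat ^ 'n \<Rightarrow> (rat ^ 'n) set" where
  "tan_at P x = {v. \<exists>d>0. \<forall>e. 0 < e \<and> e < d \<longrightarrow> x + e *s v \<in> P}"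

definition supp_cone :: "(rat ^ 'n) set \<Rightarrow> (rat ^ 'n) set \<Rightarrow> (rat ^ 'n) set" where
  "supp_cone P F = {x + v |x v. x \<in> rel_int F \<and> v \<in> tan_at P x}"

text \<open>Every cone in \<open>W\<close> is \<open>s + C\<close> with \<open>s \<in> W\<close> and \<open>C = cone0 Q A\<close> for a finite \<open>A\<close>.  Its largest affine
  subspace is \<open>s + (C \<inter> -C)\<close>.\<close>

definition cone0 :: "rat ^ 'n ^ 'n \<Rightarrow> (rat ^ 'n) set \<Rightarrow> (rat ^ 'n) set" where
  "cone0 Q A = {x \<in> quot_space Q. \<forall>a\<in>A. pair a x \<le> 0}"

definition lattice_cone :: "rat ^ 'n ^ 'n \<Rightarrow> (rat ^ 'n) set \<Rightarrow> bool" where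
  "lattice_cone Q K \<longleftrightarrow>
     (\<exists>s A. s \<in> quot_space Q \<and> finite A \<and> K = (+) s ` cone0 Q A \<and>
        (+) s ` (cone0 Q A \<inter> uminus ` cone0 Q A) \<inter> quot_lattice Q \<noteq> {})"

text \<open>If \<open>P\<close> has vertices, these are exactly its minimal faces.\<close>

definition lattice_polyhedron :: "rat ^ 'n ^ 'n \<Rightarrow> (rat ^ 'n) set \<Rightarrow> bool" where
  "lattice_polyhedron Q P \<longleftrightarrow> polyhedron_in Q P \<and>
     (\<forall>F\<in>faces P. (\<forall>G\<in>faces P. \<not> G \<subset> F) \<longrightarrow> F \<inter> quot_lattice Q \<noteq> {})"

definition lattice_polytope :: "rat ^ 'n ^ 'n \<Rightarrow> (rat ^ 'n) set \<Rightarrow> bool" where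
  "lattice_polytope Q P \<longleftrightarrow> lattice_polyhedron Q P \<and> bounded_rat P"

definition contains_line :: "(rat ^ 'n) set \<Rightarrow> bool" where
  "contains_line P \<longleftrightarrow> (\<exists>x v. v \<noteq> 0 \<and> (\<forall>t. x + t *s v \<in> P))"

text \<open>The rational points of a real polyhedron with rational inequalities are dense in it.\<close>

definition real_hull :: "(rat ^ 'n) set \<Rightarrow> (real ^ 'n) set" where
  "real_hull P = closure (emb ` P)"

definition lattice_basis :: "(rat ^ 'n) set \<Rightarrow> (rat ^ 'n) set \<Rightarrow> bool" where
  "lattice_basis M B \<longleftrightarrow> finite B \<and> B \<subseteq> M \<and> vec.independent B \<and>
     M = {\<Sum>b\<in>B. of_int (c b) *s b |c :: rat ^ 'n \<Rightarrow> int. True}"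

text \<open>The image of Lebesgue measure on \<open>\<real>\<^sup>B\<close> under \<open>t \<mapsto> p + (\<Sum>b\<in>B. t b b)\<close>, where \<open>p \<in> P\<close> and \<open>B\<close> is a
  basis of the lattice of \<open>lin P\<close>; it depends neither on \<open>p\<close> nor on \<open>B\<close>.  If \<open>P\<close> is a point
  then \<open>B = {}\<close> and this is the unit mass at \<open>p\<close>.\<close>

definition aff_measure :: "rat ^ 'n ^ 'n \<Rightarrow> (rat ^ 'n) set \<Rightarrow> (real ^ 'n) measure" where
  "aff_measure Q P =
     (let p = (SOME p. p \<in> P); B = (SOME B. lattice_basis (quot_lattice Q \<inter> lin P) B)
      in distr (\<Pi>\<^sub>M b\<in>B. lborel) borel (\<lambda>t. emb p + (\<Sum>b\<in>B. t b *\<^sub>R emb b)))"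

definition vol :: "(rat ^ 'n) set \<Rightarrow> real" where
  "vol P = measure (aff_measure (mat 1) P) (real_hull P)"

text \<open>In what follows \<open>X\<close> is a complex subspace of \<open>\<complex>\<^sup>n\<close>.\<close>

definition holo_at :: "(complex ^ 'n) set \<Rightarrow> (complex ^ 'n \<Rightarrow> complex) \<Rightarrow> complex ^ 'n \<Rightarrow> bool" where
  "holo_at X f z \<longleftrightarrow> (\<exists>r>0. \<forall>w\<in>X \<inter> ball z r. \<exists>f'.
     (f has_derivative f') (at w within X) \<and> (\<forall>c v. f' (c *s v) = c * f' v))"

definition locally_quotient :: "(complex ^ 'n) set \<Rightarrow> (complex ^ 'n \<Rightarrow> complex) \<Rightarrow> bool" where
  "locally_quotient X f \<longleftrightarrow> (\<forall>z\<in>X. \<exists>r>0. \<exists>g h.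
     (\<forall>w\<in>X \<inter> ball z r. holo_at X g w \<and> holo_at X h w) \<and>
     (\<exists>w\<in>X \<inter> ball z r. h w \<noteq> 0) \<and>
     (\<forall>w\<in>X \<inter> ball z r. h w \<noteq> 0 \<longrightarrow> f w = g w / h w))"

text \<open>A meromorphic function on \<open>X\<close> is represented by its normalized total function: it is holomorphic
  at every point to which it extends holomorphically, and it is \<open>0\<close> at all other points and
  outside \<open>X\<close>.  Thus elements of \<open>mero X\<close> are equal as meromorphic functions only if
  they are equal as functions.\<close>

definition mero :: "(complex ^ 'n) set \<Rightarrow> (complex ^ 'n \<Rightarrow> complex) set" where
  "mero X = {f. locally_quotient X f \<and> (\<forall>z. z \<notin> X \<longrightarrow> f z = 0) \<and>
     (\<forall>z\<in>X. \<not> holo_at X f z \<longrightarrow> f z = 0 \<and>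
        \<not> (\<exists>g. holo_at X g z \<and> (\<exists>r>0. \<forall>w\<in>X \<inter> ball z r. holo_at X f w \<longrightarrow> f w = g w)))}"

text \<open>Pointwise sums and products of normalized functions need not be normalized; identities between
  them in the algebra of meromorphic functions hold on a dense open subset.\<close>

definition mero_eq ::
    "(complex ^ 'n) set \<Rightarrow> (complex ^ 'n \<Rightarrow> complex) \<Rightarrow> (complex ^ 'n \<Rightarrow> complex) \<Rightarrow> bool" where
  "mero_eq X f g \<longleftrightarrow>
     (\<exists>D. openin (top_of_set X) D \<and> X \<subseteq> closure D \<and> (\<forall>z\<in>D. f z = g z))"

text \<open>A meromorphic function on \<open>\<complex>\<^sup>n\<close> restricts to \<open>X\<close> if \<open>X\<close> is not contained in its non-regular
  locus; the restriction is then given by its values at the regular points in \<open>X\<close>.\<close>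

definition restricts_to :: "(complex ^ 'n \<Rightarrow> complex) \<Rightarrow> (complex ^ 'n) set \<Rightarrow> bool" where
  "restricts_to f X \<longleftrightarrow> X \<subseteq> closure {z \<in> X. holo_at UNIV f z}"

definition exp_sum :: "rat ^ 'n ^ 'n \<Rightarrow> (rat ^ 'n) set \<Rightarrow> complex ^ 'n \<Rightarrow> complex" where
  "exp_sum Q P = (THE f. f \<in> mero (quot_cdual Q) \<and>
     (if contains_line P then f = (\<lambda>_. 0)
      else \<forall>\<xi>\<in>quot_cdual Q.
        (\<lambda>x. norm (exp (quot_pair Q \<xi> (emb x)))) summable_on (P \<inter> quot_lattice Q) \<longrightarrow>
        f \<xi> = (\<Sum>\<^sub>\<infinity>x\<in>P \<inter> quot_lattice Q. exp (quot_pair Q \<xi> (emb x)))))"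

definition exp_integral :: "rat ^ 'n ^ 'n \<Rightarrow> (rat ^ 'n) set \<Rightarrow> complex ^ 'n \<Rightarrow> complex" where
  "exp_integral Q P = (THE f. f \<in> mero (quot_cdual Q) \<and>
     (if contains_line P then f = (\<lambda>_. 0)
      else \<forall>\<xi>\<in>quot_cdual Q.
        set_integrable (aff_measure Q P) (real_hull P) (\<lambda>x. exp (quot_pair Q \<xi> (cvec x))) \<longrightarrow>
        f \<xi> = (LINT x:real_hull P|aff_measure Q P. exp (quot_pair Q \<xi> (cvec x)))))"

definition direct_sum :: "(rat ^ 'n) set \<Rightarrow> (rat ^ 'n) set \<Rightarrow> (rat ^ 'n) set \<Rightarrow> bool" where
  "direct_sum X A B \<longleftrightarrow> vec.subspace A \<and> vec.subspace B \<and> A \<inter> B = {0} \<and>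
     X = {a + b |a b. a \<in> A \<and> b \<in> B}"

text \<open>A complement map is a partial map on sets of vectors whose domain is the collection
  \<open>\<L>\<^sup>\<Psi>\<close>.\<close>

type_synonym 'n compl_map = "(rat ^ 'n) set \<rightharpoonup> (rat ^ 'n) set"

definition rigid_complement_map :: "'n::finite compl_map \<Rightarrow> bool" where
  "rigid_complement_map \<Psi> \<longleftrightarrow>
     (\<forall>U\<in>dom \<Psi>. direct_sum UNIV U (the (\<Psi> U))) \<and>
     (\<forall>U1\<in>dom \<Psi>. \<forall>U2\<in>dom \<Psi>. U1 \<subseteq> U2 \<longrightarrow> the (\<Psi> U2) \<subseteq> the (\<Psi> U1))"

definition induced_map :: "rat ^ 'n ^ 'n \<Rightarrow> 'n::finite compl_map \<Rightarrow> 'n compl_map" where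
  "induced_map Q \<Psi> = (\<lambda>U.
     if U \<in> dom \<Psi> \<and> U \<subseteq> quot_dual Q {0} \<and>
        direct_sum (quot_dual Q {0}) U (the (\<Psi> U) \<inter> quot_dual Q {0})
     then Some (the (\<Psi> U) \<inter> quot_dual Q {0}) else None)"

definition generic_quotient :: "'n::finite compl_map \<Rightarrow> rat ^ 'n ^ 'n \<Rightarrow> bool" where
  "generic_quotient \<Psi> Q \<longleftrightarrow> quot_dual Q {0} \<in> dom \<Psi>"

text \<open>Below, \<open>\<Psi>\<close> is a complement map on \<open>W\<^sup>*\<close>.\<close>

definition generic_subspace ::
    "rat ^ 'n ^ 'n \<Rightarrow> 'n::finite compl_map \<Rightarrow> (rat ^ 'n) set \<Rightarrow> bool" where
  "generic_subspace Q \<Psi> U \<longleftrightarrow> quot_dual Q U \<in> dom \<Psi>"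

definition generic_cone ::
    "rat ^ 'n ^ 'n \<Rightarrow> 'n::finite compl_map \<Rightarrow> (rat ^ 'n) set \<Rightarrow> bool" where
  "generic_cone Q \<Psi> K \<longleftrightarrow> (\<forall>F\<in>faces K. generic_subspace Q \<Psi> (lin F))"

definition generic_polyhedron ::
    "rat ^ 'n ^ 'n \<Rightarrow> 'n::finite compl_map \<Rightarrow> (rat ^ 'n) set \<Rightarrow> bool" where
  "generic_polyhedron Q \<Psi> P \<longleftrightarrow> (\<forall>F\<in>faces P. generic_cone Q \<Psi> (supp_cone P F))"

definition quot_proj ::
    "rat ^ 'n ^ 'n \<Rightarrow> 'n::finite compl_map \<Rightarrow> complex ^ 'n \<Rightarrow> complex ^ 'n" where
  "quot_proj Q \<Psi> \<xi> = (THE \<eta>. \<eta> \<in> quot_cdual Q \<and>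
     \<xi> - \<eta> \<in> complexify (the (\<Psi> (quot_dual Q {0}))))"

definition IS_identity ::
    "rat ^ 'n ^ 'n \<Rightarrow> 'n::finite compl_map \<Rightarrow>
     ((rat ^ 'n) set \<Rightarrow> complex ^ 'n \<Rightarrow> complex) \<Rightarrow> bool" where
  "IS_identity Q \<Psi> lam \<longleftrightarrow>
     (\<forall>P. lattice_polyhedron Q P \<and> generic_polyhedron Q \<Psi> P \<longrightarrow>
        mero_eq (quot_cdual Q) (exp_integral Q P)
          (\<lambda>\<xi>. \<Sum>F\<in>faces P. lam (supp_cone P F) \<xi> * exp_sum Q F \<xi>))"

text \<open>The value \<open>lam K\<close> matters only for generic lattice cones \<open>K\<close> of \<open>V\<close>.  The preimage \<open>q\<inverse>(K)\<close> is
  \<open>(*v) Q -` K\<close>.  Since \<open>IS_identity Q\<close> only looks at functions on a dense open subset of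
  \<open>W\<^sup>*\<^sub>\<complex>\<close>, the restriction to \<open>W\<^sup>*\<^sub>\<complex>\<close> is left implicit there.\<close>

definition IS_interpolator ::
    "'n::finite compl_map \<Rightarrow> ((rat ^ 'n) set \<Rightarrow> complex ^ 'n \<Rightarrow> complex) \<Rightarrow> bool" where
  "IS_interpolator \<Psi> lam \<longleftrightarrow>
     (\<forall>K. lattice_cone (mat 1) K \<and> generic_cone (mat 1) \<Psi> K \<longrightarrow> lam K \<in> mero UNIV) \<and>
     IS_identity (mat 1) \<Psi> lam \<and>
     (\<forall>Q. generic_quotient \<Psi> Q \<longrightarrow>
        (\<forall>K. lattice_cone Q K \<and> generic_cone Q (induced_map Q \<Psi>) K \<longrightarrow>
           restricts_to (lam ((*v) Q -` K)) (quot_cdual Q)) \<and>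
        IS_identity Q (induced_map Q \<Psi>) (\<lambda>K. lam ((*v) Q -` K)) \<and>
        (\<forall>K. lattice_cone Q K \<and> generic_cone Q (induced_map Q \<Psi>) K \<longrightarrow>
           mero_eq UNIV (lam ((*v) Q -` K)) (\<lambda>\<xi>. lam ((*v) Q -` K) (quot_proj Q \<Psi> \<xi>))))"

definition has_taylor ::
    "(complex ^ 'n \<Rightarrow> complex) \<Rightarrow> (('n \<Rightarrow> nat) \<Rightarrow> complex) \<Rightarrow> bool" where
  "has_taylor f a \<longleftrightarrow> (\<exists>r>0. \<forall>\<xi>. (\<forall>i. norm (\<xi> $ i) < r) \<longrightarrow>
     ((\<lambda>\<alpha>. a \<alpha> * (\<Prod>i\<in>UNIV. (\<xi> $ i) ^ \<alpha> i)) has_sum f \<xi>) UNIV)"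

definition analytic_at_0 :: "(complex ^ 'n \<Rightarrow> complex) \<Rightarrow> bool" where
  "analytic_at_0 f \<longleftrightarrow> (\<exists>a. has_taylor f a)"

definition taylor_coeff :: "(complex ^ 'n \<Rightarrow> complex) \<Rightarrow> ('n \<Rightarrow> nat) \<Rightarrow> complex" where
  "taylor_coeff f = (THE a. has_taylor f a)"

definition partial :: "'n \<Rightarrow> (real ^ 'n \<Rightarrow> complex) \<Rightarrow> real ^ 'n \<Rightarrow> complex" where
  "partial i h x = vector_derivative (\<lambda>t. h (x + t *\<^sub>R axis i 1)) (at 0)"

text \<open>The coordinates are differentiated in some fixed order, which is irrelevant for smooth \<open>h\<close>.\<close>

definition partials :: "('n::finite \<Rightarrow> nat) \<Rightarrow> (real ^ 'n \<Rightarrow> complex) \<Rightarrow> real ^ 'n \<Rightarrow> complex" where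
  "partials \<alpha> h = foldr (\<lambda>i g. (partial i ^^ \<alpha> i) g) (SOME is. distinct is \<and> set is = UNIV) h"

text \<open>For polynomial \<open>h\<close> only finitely many terms are nonzero.\<close>

definition diff_op ::
    "(complex ^ 'n::finite \<Rightarrow> complex) \<Rightarrow> (real ^ 'n \<Rightarrow> complex) \<Rightarrow> real ^ 'n \<Rightarrow> complex" where
  "diff_op f h x = (\<Sum>\<^sub>\<infinity>\<alpha>. taylor_coeff f \<alpha> * partials \<alpha> h x)"

end

theory Submission
  imports Defs
begin

text \<open>
  Both sides of the defining identity \<open>I(P) = \<Sum>\<^sub>F \<lambda>(Supp(P,F)) S(F)\<close> are analytic at \<open>0\<close> when \<open>P\<close> is a
  polytope: \<open>I(P)\<close> and \<open>S(F)\<close> are entire, and each supporting cone is a generic lattice cone.  The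
  identity holds on a dense set, hence near \<open>0\<close>, and the claim for \<open>h = x\<^sup>\<gamma>\<close> is the equality of the
  Taylor coefficients at \<open>\<xi>\<^sup>\<gamma>\<close>, multiplied by \<open>\<gamma>!\<close>.
\<close>

subsection \<open>Multivariate power series\<close>

text \<open>\<open>exp_sum\<close> and \<open>exp_integral\<close> are selected by
  \<open>THE\<close> among normalized meromorphic functions, and the defining identity is only a
  \<open>mero_eq\<close>, so it cannot be evaluated near 0 directly. For bounded sets the sum and
  the integral converge at every \<xi>, which pins the selected function down pointwise; what has to
  be supplied is that the functions obtained are entire. Agreement on a dense set becomes equality
  near 0 because both sides are continuous there. Let a be the Taylor coefficients of the
  interpolator at a face. In its product with exp <\<xi>, x> the coefficient of \<xi>^\<gamma> is
  the sum over \<alpha> \<le> \<gamma> of a(\<alpha>) x^(\<gamma> - \<alpha>) / (\<gamma> -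
  \<alpha>)!. Multiplying by \<gamma>! produces the factor \<gamma>! / (\<gamma> - \<alpha>)!,
  exactly the factor that appears when the partial derivative of order \<alpha> is applied to
  x^\<gamma>. This is why coefficients of a product of functions turn into values of a differential
  operator.\<close>

definition mpow :: "'a::comm_semiring_1 ^ 'n \<Rightarrow> ('n \<Rightarrow> nat) \<Rightarrow> 'a" where
  "mpow z \<alpha> = (\<Prod>i\<in>UNIV. (z $ i) ^ \<alpha> i)"

definition mfact :: "('n::finite \<Rightarrow> nat) \<Rightarrow> nat" where
  "mfact \<alpha> = (\<Prod>i\<in>UNIV. fact (\<alpha> i))"

text \<open>Exponents in the variables from \<open>S\<close> only, kept inside the full type of
  multi-indices so that inductions can add one variable at a time.\<close>

definition supported_on :: "'n set \<Rightarrow> ('n \<Rightarrow> nat) set" where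
  "supported_on S = {\<alpha>. \<forall>i. i \<notin> S \<longrightarrow> \<alpha> i = 0}"

lemma supported_on_empty: "supported_on {} = {\<lambda>_. 0}"
  by (auto simp: supported_on_def)

lemma supported_on_UNIV: "supported_on UNIV = UNIV"
  by (auto simp: supported_on_def)

lemma has_sum_supported_on_insert:
  assumes "i \<notin> S"
  shows "(f has_sum s) (supported_on (insert i S)) \<longleftrightarrow>
    ((\<lambda>(k, \<alpha>). f (\<alpha>(i := k))) has_sum s) (UNIV \<times> supported_on S)"
  by (rule has_sum_reindex_bij_witness[where j = "\<lambda>\<alpha>. (\<alpha> i, \<alpha>(i := 0))" and i = "\<lambda>(k, \<alpha>). \<alpha>(i := k)"])
     (use assms in \<open>auto simp: supported_on_def fun_eq_iff\<close>)

text \<open>For complex families unconditional and absolute summability coincide, so summability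
  over the product follows from that of the two factors.\<close>

lemma has_sum_product_complex:
  fixes f :: "'a \<Rightarrow> complex" and g :: "'b \<Rightarrow> complex"
  assumes f: "(f has_sum a) A" and g: "(g has_sum b) B"
  shows "((\<lambda>(x, y). f x * g y) has_sum a * b) (A \<times> B)"
proof (rule has_sum_SigmaI)
  show "((\<lambda>y. case (x, y) of (x, y) \<Rightarrow> f x * g y) has_sum f x * b) B" for x
    using has_sum_cmult_right[OF g, of "f x"] by simp
  show "((\<lambda>x. f x * b) has_sum a * b) A"
    using has_sum_cmult_left[OF f] by simp
  have "(\<lambda>x. norm (f x)) summable_on A" "(\<lambda>y. norm (g y)) summable_on B"
    using f g has_sum_imp_summable summable_on_iff_abs_summable_on_complex by blast+
  then have "(\<lambda>z. norm (case z of (x, y) \<Rightarrow> f x * g y)) summable_on A \<times> B"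
    by (subst Infinite_Sum.abs_summable_on_Sigma_iff)
       (auto simp: norm_mult abs_mult infsum_nonneg infsum_cmult_right' intro!: summable_on_cmult_right summable_on_cmult_left)
  then show "(\<lambda>(x, y). f x * g y) summable_on A \<times> B"
    using summable_on_iff_abs_summable_on_complex by blast
qed

text \<open>The radius of convergence is at least \<open>r\<close>, so a formal power series that
  evaluates to 0 near 0 is itself 0.\<close>

lemma powser_eq_0_imp_coeff_eq_0:
  fixes c :: "nat \<Rightarrow> complex"
  assumes r: "r > 0" and c: "\<And>z. norm z < r \<Longrightarrow> (\<lambda>n. c n * z ^ n) sums 0"
  shows "c n = 0"
proof -
  have "Abs_fps c = 0"
  proof (rule eval_fps_eqD)
    have "ereal r \<le> conv_radius c"
      using c by (intro conv_radius_geI_ex') (auto simp: sums_iff)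
    then show "fps_conv_radius (Abs_fps c) > 0"
      using r by (simp add: fps_conv_radius_def less_le_trans[of 0 "ereal r"])
    show "eventually (\<lambda>z. eval_fps (Abs_fps c) z = eval_fps 0 z) (nhds 0)"
      unfolding eventually_nhds_metric using r c
      by (intro exI[of _ r]) (auto simp: eval_fps_def sums_iff)
  qed simp
  then show ?thesis by (metis Abs_fps_inverse UNIV_I fps_nth_Abs_fps fps_zero_nth)
qed

text \<open>Regroup the series as a power series in the new variable. Its coefficients vanish by the
  one-variable case, and they are in turn power series in the variables of \<open>S\<close>, to
  which the induction hypothesis applies.\<close>

lemma multi_powser_eq_0_imp_coeff_eq_0_aux:
  fixes a :: "('n \<Rightarrow> nat) \<Rightarrow> complex"
  assumes "finite S" "r > 0"
    and "\<And>z. (\<forall>i. norm (z i) < r) \<Longrightarrow>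
           ((\<lambda>\<alpha>. a \<alpha> * (\<Prod>i\<in>S. z i ^ \<alpha> i)) has_sum 0) (supported_on S)"
    and "\<alpha> \<in> supported_on S"
  shows "a \<alpha> = 0"
  using assms(1,3,4)
proof (induction S arbitrary: a \<alpha> rule: finite_induct)
  case empty
  have "((\<lambda>\<alpha>. a \<alpha>) has_sum 0) {\<lambda>_. 0}"
    using empty.prems(1)[of "\<lambda>_. 0"] assms(2) by (simp add: supported_on_empty)
  then show ?case using empty.prems(2)
    by (auto simp: supported_on_empty has_sum_finite_iff)
next
  case (insert i S)
  define c where "c z k = (\<Sum>\<^sub>\<infinity>\<beta>\<in>supported_on S. a (\<beta>(i := k)) * (\<Prod>j\<in>S. z j ^ \<beta> j))" for z k
  have prod_upd: "(\<Prod>j\<in>S. z j ^ (\<beta>(i := k)) j) = (\<Prod>j\<in>S. z j ^ \<beta> j)" for z :: "'n \<Rightarrow> complex" and \<beta> k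
    using insert.hyps by (intro prod.cong) auto
  have ser: "((\<lambda>\<beta>. a (\<beta>(i := k)) * (\<Prod>j\<in>S. z j ^ \<beta> j)) has_sum 0) (supported_on S)"
    if z: "\<forall>j. norm (z j) < r" for z k
  proof -
    have sig: "((\<lambda>(k, \<beta>). a (\<beta>(i := k)) * (w ^ k * (\<Prod>j\<in>S. z j ^ \<beta> j))) has_sum 0)
        (UNIV \<times> supported_on S)" if "norm w < r" for w
    proof -
      have "(\<Prod>j\<in>S. (z(i := w)) j ^ \<beta> j) = (\<Prod>j\<in>S. z j ^ \<beta> j)" for \<beta>
        using insert.hyps by (intro prod.cong) auto
      moreover have "((\<lambda>\<alpha>. a \<alpha> * (\<Prod>j\<in>insert i S. (z(i := w)) j ^ \<alpha> j)) has_sum 0) (supported_on (insert i S))"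
        using that z by (intro insert.prems(1)) auto
      ultimately show ?thesis
        using insert.hyps
        by (simp add: has_sum_supported_on_insert prod_upd del: fun_upd_apply) (simp add: fun_upd_same)
    qed
    \<comment> \<open>A slice of a summable family is summable; the slice is taken at the nonzero
      point \<open>r/2\<close> of the new variable, whose power can then be divided out.\<close>
    have inner: "(\<lambda>\<beta>. a (\<beta>(i := k)) * (\<Prod>j\<in>S. z j ^ \<beta> j)) summable_on supported_on S" for k
    proof -
      have "(\<lambda>\<beta>. a (\<beta>(i := k)) * (of_real (r/2) ^ k * (\<Prod>j\<in>S. z j ^ \<beta> j))) summable_on supported_on S"
        using has_sum_imp_summable[OF sig[of "of_real (r/2)"]] assms(2)
        by (intro summable_on_SigmaD1[where x = k and A = UNIV and
              f = "\<lambda>k \<beta>. a (\<beta>(i := k)) * (of_real (r/2) ^ k * (\<Prod>j\<in>S. z j ^ \<beta> j))"]) auto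
      then have "(\<lambda>\<beta>. (a (\<beta>(i := k)) * (of_real (r/2) ^ k * (\<Prod>j\<in>S. z j ^ \<beta> j))) * (1 / of_real (r/2) ^ k))
          summable_on supported_on S"
        by (rule summable_on_cmult_left)
      then show ?thesis using assms(2) by (simp add: mult.assoc)
    qed
    then have inner_sum: "((\<lambda>\<beta>. a (\<beta>(i := k)) * (\<Prod>j\<in>S. z j ^ \<beta> j)) has_sum c z k) (supported_on S)" for k
      by (simp add: c_def)
    have "(\<lambda>k. c z k * w ^ k) sums 0" if "norm w < r" for w
    proof (rule has_sum_imp_sums, rule has_sum_SigmaD[OF sig[OF that]])
      show "((\<lambda>\<beta>. case (k, \<beta>) of (k, \<beta>) \<Rightarrow> a (\<beta>(i := k)) * (w ^ k * (\<Prod>j\<in>S. z j ^ \<beta> j)))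
          has_sum c z k * w ^ k) (supported_on S)" for k
        using has_sum_cmult_left[OF inner_sum[of k], of "w ^ k"] by (simp add: mult_ac)
    qed
    then have "c z k = 0" for k by (rule powser_eq_0_imp_coeff_eq_0[OF assms(2)])
    then show ?thesis using inner_sum[of k] by simp
  qed
  have "a ((\<alpha>(i := 0))(i := \<alpha> i)) = 0"
    by (rule insert.IH[of "\<lambda>\<beta>. a (\<beta>(i := \<alpha> i))"])
       (use ser insert.prems(2) in \<open>auto simp: supported_on_def\<close>)
  then show ?case by simp
qed

lemma has_taylor_mpow:
  "has_taylor f a \<longleftrightarrow> (\<exists>r>0. \<forall>\<xi>. (\<forall>i. norm (\<xi> $ i) < r) \<longrightarrow> ((\<lambda>\<alpha>. a \<alpha> * mpow \<xi> \<alpha>) has_sum f \<xi>) UNIV)"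
  by (simp add: has_taylor_def mpow_def)

lemma has_taylor_unique:
  assumes "has_taylor f a" "has_taylor f b"
  shows "a = b"
proof
  fix \<alpha>
  obtain r s where r: "r > 0" "\<And>\<xi>. \<forall>i. norm (\<xi> $ i) < r \<Longrightarrow> ((\<lambda>\<alpha>. a \<alpha> * mpow \<xi> \<alpha>) has_sum f \<xi>) UNIV"
    and s: "s > 0" "\<And>\<xi>. \<forall>i. norm (\<xi> $ i) < s \<Longrightarrow> ((\<lambda>\<alpha>. b \<alpha> * mpow \<xi> \<alpha>) has_sum f \<xi>) UNIV"
    using assms unfolding has_taylor_mpow by metis
  have "a \<alpha> - b \<alpha> = 0"
  proof (rule multi_powser_eq_0_imp_coeff_eq_0_aux[where S = UNIV and r = "min r s" and a = "\<lambda>\<alpha>. a \<alpha> - b \<alpha>"])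
    fix z :: "'a \<Rightarrow> complex"
    assume z: "\<forall>i. norm (z i) < min r s"
    have "((\<lambda>\<alpha>. a \<alpha> * mpow (vec_lambda z) \<alpha> - b \<alpha> * mpow (vec_lambda z) \<alpha>) has_sum f (vec_lambda z) - f (vec_lambda z)) UNIV"
      unfolding diff_conv_add_uminus
      using z by (intro has_sum_add has_sum_uminusI r s) auto
    then show "((\<lambda>\<alpha>. (a \<alpha> - b \<alpha>) * (\<Prod>i\<in>UNIV. z i ^ \<alpha> i)) has_sum 0) (supported_on UNIV)"
      by (simp add: supported_on_UNIV mpow_def left_diff_distrib)
  qed (use r s in \<open>auto simp: supported_on_UNIV\<close>)
  then show "a \<alpha> = b \<alpha>" by simp
qed

lemma taylor_coeff_eq:
  assumes "has_taylor f a"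
  shows "taylor_coeff f = a"
  unfolding taylor_coeff_def using assms has_taylor_unique by blast

lemma has_taylor_add:
  assumes "has_taylor f a" "has_taylor g b"
  shows "has_taylor (\<lambda>\<xi>. f \<xi> + g \<xi>) (\<lambda>\<alpha>. a \<alpha> + b \<alpha>)"
proof -
  obtain r s where r: "r > 0" "\<And>\<xi>. \<forall>i. norm (\<xi> $ i) < r \<Longrightarrow> ((\<lambda>\<alpha>. a \<alpha> * mpow \<xi> \<alpha>) has_sum f \<xi>) UNIV"
    and s: "s > 0" "\<And>\<xi>. \<forall>i. norm (\<xi> $ i) < s \<Longrightarrow> ((\<lambda>\<alpha>. b \<alpha> * mpow \<xi> \<alpha>) has_sum g \<xi>) UNIV"
    using assms unfolding has_taylor_mpow by metis
  show ?thesis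
    unfolding has_taylor_mpow using r s
    by (intro exI[of _ "min r s"]) (auto simp: distrib_right intro!: has_sum_add)
qed

lemma has_taylor_sum:
  assumes "\<And>x. x \<in> X \<Longrightarrow> has_taylor (f x) (a x)"
  shows "has_taylor (\<lambda>\<xi>. \<Sum>x\<in>X. f x \<xi>) (\<lambda>\<alpha>. \<Sum>x\<in>X. a x \<alpha>)"
  using assms
proof (induction X rule: infinite_finite_induct)
  case (insert x X)
  then show ?case by (auto intro!: has_taylor_add)
qed (auto simp: has_taylor_def intro: exI[of _ 1])

lemma has_taylor_cong:
  assumes f: "has_taylor f a" and r: "r > 0" and eq: "\<And>\<xi>. \<forall>i. norm (\<xi> $ i) < r \<Longrightarrow> f \<xi> = g \<xi>"
  shows "has_taylor g a"
proof -
  obtain s where s: "s > 0" "\<And>\<xi>. \<forall>i. norm (\<xi> $ i) < s \<Longrightarrow> ((\<lambda>\<alpha>. a \<alpha> * mpow \<xi> \<alpha>) has_sum f \<xi>) UNIV"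
    using f unfolding has_taylor_mpow by metis
  show ?thesis
    unfolding has_taylor_mpow using r s eq[symmetric] by (intro exI[of _ "min r s"]) auto
qed

section \<open>Cauchy products, and continuity of Taylor series near 0\<close>

definition below :: "('n \<Rightarrow> nat) \<Rightarrow> ('n \<Rightarrow> nat) set" where
  "below \<gamma> = {\<alpha>. \<forall>i. \<alpha> i \<le> \<gamma> i}"

lemma finite_below: "finite (below (\<gamma> :: 'n::finite \<Rightarrow> nat))"
proof -
  have "below \<gamma> = PiE UNIV (\<lambda>i. {..\<gamma> i})" by (auto simp: below_def PiE_def)
  then show ?thesis by (simp add: finite_PiE)
qed

text \<open>The double series is reindexed by (\<alpha> + \<beta>, \<alpha>); for a fixed total
  exponent \<gamma> only the finite box \<open>below \<gamma>\<close> remains.\<close>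

lemma has_taylor_mult:
  assumes "has_taylor f a" "has_taylor g b"
  shows "has_taylor (\<lambda>\<xi>. f \<xi> * g \<xi>) (\<lambda>\<gamma>. \<Sum>\<alpha>\<in>below \<gamma>. a \<alpha> * b (\<lambda>i. \<gamma> i - \<alpha> i))"
proof -
  obtain r s where r: "r > 0" "\<And>\<xi>. \<forall>i. norm (\<xi> $ i) < r \<Longrightarrow> ((\<lambda>\<alpha>. a \<alpha> * mpow \<xi> \<alpha>) has_sum f \<xi>) UNIV"
    and s: "s > 0" "\<And>\<xi>. \<forall>i. norm (\<xi> $ i) < s \<Longrightarrow> ((\<lambda>\<alpha>. b \<alpha> * mpow \<xi> \<alpha>) has_sum g \<xi>) UNIV"
    using assms unfolding has_taylor_mpow by metis
  have "((\<lambda>\<gamma>. (\<Sum>\<alpha>\<in>below \<gamma>. a \<alpha> * b (\<lambda>i. \<gamma> i - \<alpha> i)) * mpow \<xi> \<gamma>) has_sum f \<xi> * g \<xi>) UNIV"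
    if \<xi>: "\<forall>i. norm (\<xi> $ i) < min r s" for \<xi>
  proof -
    have "((\<lambda>(\<alpha>, \<beta>). (a \<alpha> * mpow \<xi> \<alpha>) * (b \<beta> * mpow \<xi> \<beta>)) has_sum f \<xi> * g \<xi>) (UNIV \<times> UNIV)"
      using \<xi> by (intro has_sum_product_complex r s) auto
    also have "?this \<longleftrightarrow> ((\<lambda>(\<gamma>, \<alpha>). a \<alpha> * b (\<lambda>i. \<gamma> i - \<alpha> i) * mpow \<xi> \<gamma>) has_sum f \<xi> * g \<xi>) (Sigma UNIV below)"
      by (rule has_sum_reindex_bij_witness[where j = "\<lambda>(\<alpha>, \<beta>). (\<lambda>i. \<alpha> i + \<beta> i, \<alpha>)"
            and i = "\<lambda>(\<gamma>, \<alpha>). (\<alpha>, \<lambda>i. \<gamma> i - \<alpha> i)"])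
         (auto simp: below_def mpow_def power_add prod.distrib mult_ac)
    finally have "((\<lambda>(\<gamma>, \<alpha>). a \<alpha> * b (\<lambda>i. \<gamma> i - \<alpha> i) * mpow \<xi> \<gamma>) has_sum f \<xi> * g \<xi>) (Sigma UNIV below)" .
    then show ?thesis
      by (rule has_sum_SigmaD) (auto simp: sum_distrib_right finite_below intro!: has_sum_finiteI)
  qed
  then show ?thesis unfolding has_taylor_mpow using r s by (intro exI[of _ "min r s"]) auto
qed

definition polydisc :: "real \<Rightarrow> (complex ^ 'n) set" where
  "polydisc r = {\<xi>. \<forall>i. norm (\<xi> $ i) < r}"

lemma open_polydisc: "open (polydisc r :: (complex ^ 'n) set)"
proof -
  have "polydisc r = (\<Inter>i. {\<xi> :: complex ^ 'n. norm (\<xi> $ i) < r})" by (auto simp: polydisc_def)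
  moreover have "open {\<xi> :: complex ^ 'n. norm (\<xi> $ i) < r}" for i
    by (intro open_Collect_less continuous_intros)
  ultimately show ?thesis by (simp add: open_INT)
qed

lemma norm_mpow: "norm (mpow (\<xi> :: 'a::{real_normed_field} ^ 'n) \<alpha>) = (\<Prod>i\<in>UNIV. norm (\<xi> $ i) ^ \<alpha> i)"
  by (simp add: mpow_def prod_norm[symmetric] norm_power)

text \<open>On the polydisc of half the radius the absolutely convergent series at the corner point
  (r/2, ..., r/2) is a majorant, so the Weierstrass test gives uniform convergence.\<close>

lemma has_taylor_continuous:
  assumes "has_taylor f a"
  shows "\<exists>r>0. continuous_on (polydisc r) f"
proof -
  obtain r where r: "r > 0" "\<And>\<xi>. \<forall>i. norm (\<xi> $ i) < r \<Longrightarrow> ((\<lambda>\<alpha>. a \<alpha> * mpow \<xi> \<alpha>) has_sum f \<xi>) UNIV"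
    using assms unfolding has_taylor_mpow by metis
  let ?e = "\<chi> i. complex_of_real (r / 2)"
  have "(\<lambda>\<alpha>. norm (a \<alpha> * mpow ?e \<alpha>)) summable_on UNIV"
    using r(2)[of ?e] r(1) has_sum_imp_summable summable_on_iff_abs_summable_on_complex by fastforce
  then have M: "(\<lambda>\<alpha>. norm (a \<alpha>) * (\<Prod>i\<in>UNIV. (r / 2) ^ \<alpha> i)) summable_on UNIV"
    using r(1) by (simp add: norm_mult norm_mpow)
  have "uniform_limit (polydisc (r/2)) (\<lambda>X \<xi>. \<Sum>\<alpha>\<in>X. a \<alpha> * mpow \<xi> \<alpha>) f (finite_subsets_at_top UNIV)"
    using _ _ M
  proof (rule Weierstrass_m_test_general')
    show "norm (a \<alpha> * mpow \<xi> \<alpha>) \<le> norm (a \<alpha>) * (\<Prod>i\<in>UNIV. (r / 2) ^ \<alpha> i)" if "\<xi> \<in> polydisc (r/2)" for \<alpha> \<xi>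
      using that unfolding norm_mult norm_mpow polydisc_def
      by (intro mult_left_mono prod_mono conjI power_mono) (auto intro: less_imp_le)
    show "((\<lambda>\<alpha>. a \<alpha> * mpow \<xi> \<alpha>) has_sum f \<xi>) UNIV" if "\<xi> \<in> polydisc (r/2)" for \<xi>
      using that r(1) unfolding polydisc_def by (intro r(2)) (auto intro: less_trans[of _ "r / 2"])
  qed
  then have "continuous_on (polydisc (r/2)) f"
    by (rule uniform_limit_theorem[rotated])
       (auto simp: mpow_def intro!: always_eventually continuous_intros)
  then show ?thesis using r(1) by (intro exI[of _ "r/2"]) auto
qed

lemma has_taylor_at_0:
  assumes "has_taylor f a"
  shows "f 0 = a (\<lambda>_. 0)"
proof -
  obtain r where r: "r > 0" "\<And>\<xi>. \<forall>i. norm (\<xi> $ i) < r \<Longrightarrow> ((\<lambda>\<alpha>. a \<alpha> * mpow \<xi> \<alpha>) has_sum f \<xi>) UNIV"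
    using assms unfolding has_taylor_mpow by metis
  have "((\<lambda>\<alpha>. a \<alpha> * mpow 0 \<alpha>) has_sum f 0) UNIV" using r by simp
  moreover have "((\<lambda>\<alpha>. a \<alpha> * mpow 0 \<alpha>) has_sum a (\<lambda>_. 0)) UNIV"
    by (rule has_sum_finite_neutralI[of "{\<lambda>_. 0}"]) (auto simp: mpow_def power_0_left fun_eq_iff)
  ultimately show ?thesis by (rule has_sum_unique)
qed

section \<open>Taylor series of exponentials of linear forms\<close>

lemma exp_has_sum: "((\<lambda>k. z ^ k / fact k) has_sum exp z) UNIV" for z :: complex
proof -
  have "(\<lambda>k. norm (z ^ k / fact k)) summable_on UNIV"
    by (rule norm_summable_imp_summable_on)
       (use summable_norm_exp[of z] in \<open>simp add: scaleR_conv_of_real norm_divide norm_mult divide_inverse mult.commute norm_inverse\<close>)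
  then show ?thesis
    by (intro norm_summable_imp_has_sum)
       (use summable_on_imp_summable exp_converges[of z] in \<open>auto simp: scaleR_conv_of_real divide_inverse mult.commute\<close>)
qed

text \<open>The exponential of a sum is the product of one-variable exponentials, whose series are
  multiplied one coordinate at a time.\<close>

lemma mpow_mfact_has_sum_exp:
  "((\<lambda>\<alpha>. mpow z \<alpha> / of_nat (mfact \<alpha>)) has_sum exp (\<Sum>i\<in>UNIV. z $ i)) UNIV" for z :: "complex ^ 'n"
proof -
  have "((\<lambda>\<alpha>. \<Prod>i\<in>S. z $ i ^ \<alpha> i / fact (\<alpha> i)) has_sum exp (\<Sum>i\<in>S. z $ i)) (supported_on S)"
    if "finite S" for S
    using that
  proof (induction S rule: finite_induct)
    case empty
    then show ?case by (simp add: supported_on_empty has_sum_finite_iff)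
  next
    case (insert i S)
    have *: "(\<Prod>j\<in>S. z $ j ^ (\<alpha>(i := k)) j / fact ((\<alpha>(i := k)) j)) = (\<Prod>j\<in>S. z $ j ^ \<alpha> j / fact (\<alpha> j))" for \<alpha> k
      using insert.hyps by (intro prod.cong) auto
    show ?case
      using has_sum_product_complex[OF exp_has_sum[of "z $ i"] insert.IH] insert.hyps *
      by (simp add: has_sum_supported_on_insert exp_add)
  qed
  from this[of UNIV] show ?thesis
    by (simp add: mpow_def mfact_def prod_dividef supported_on_UNIV)
qed

lemma mpow_mult: "mpow (\<chi> i. x $ i * y $ i) \<alpha> = mpow x \<alpha> * mpow y \<alpha>"
  by (simp add: mpow_def power_mult_distrib prod.distrib)

lemma exp_pair_has_sum:
  "((\<lambda>\<alpha>. mpow x \<alpha> / of_nat (mfact \<alpha>) * mpow \<xi> \<alpha>) has_sum exp (pair \<xi> x)) UNIV"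
  for x :: "complex ^ 'n"
  using mpow_mfact_has_sum_exp[of "\<chi> i. x $ i * \<xi> $ i"]
  by (simp add: mpow_mult pair_def mult.commute)

lemma has_taylor_exp_pair: "has_taylor (\<lambda>\<xi>. exp (pair \<xi> x)) (\<lambda>\<alpha>. mpow x \<alpha> / of_nat (mfact \<alpha>))"
  unfolding has_taylor_mpow using exp_pair_has_sum by (intro exI[of _ 1]) auto

subsection \<open>Faces of rational polyhedra\<close>

lemma quot_space_mat_1: "quot_space (mat 1 :: rat ^ 'n ^ 'n) = UNIV"
  by (auto simp: quot_space_def intro: range_eqI[of _ _ x for x])

lemma quot_lattice_mat_1: "quot_lattice (mat 1 :: rat ^ 'n ^ 'n) = int_lattice"
  by (simp add: quot_lattice_def)

lemma lattice_cone_mat_1I: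
  assumes "finite B" "K = (+) s ` cone0 (mat 1) B" "z \<in> int_lattice"
    and "z \<in> (+) s ` (cone0 (mat 1) B \<inter> uminus ` cone0 (mat 1) B)"
  shows "lattice_cone (mat 1) K"
proof -
  have "(+) s ` (cone0 (mat 1) B \<inter> uminus ` cone0 (mat 1) B) \<inter> int_lattice \<noteq> {}"
    using assms(3,4) by (metis IntI emptyE)
  with assms(1,2) show ?thesis
    unfolding lattice_cone_def quot_space_mat_1 quot_lattice_mat_1
    by (intro exI[of _ s] exI[of _ B] conjI UNIV_I)
qed

lemma pair_add_right: "pair a (x + y) = pair a x + pair a y"
  by (simp add: pair_def distrib_left sum.distrib)

lemma pair_diff_right: "pair a (x - y) = pair a x - pair a y"
  by (simp add: pair_def right_diff_distrib sum_subtractf)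

lemma pair_scale_right: "pair a (c *s x) = c * pair a x"
  by (simp add: pair_def sum_distrib_left mult_ac)

lemmas pair_right_simps = pair_add_right pair_diff_right pair_scale_right

text \<open>The inequalities of \<open>A\<close> that hold with equality on all of \<open>F\<close>.
  Relative interior, supporting cone and the face itself are all recovered from this finite
  set.\<close>

definition tight :: "((rat ^ 'n) \<times> rat) set \<Rightarrow> (rat ^ 'n) set \<Rightarrow> ((rat ^ 'n) \<times> rat) set" where
  "tight A F = {(a, b) \<in> A. \<forall>x\<in>F. pair a x = b}"

context
  fixes A :: "((rat ^ 'n) \<times> rat) set" and P :: "(rat ^ 'n) set"
  assumes finite_A: "finite A" and P_eq: "P = {x. \<forall>(a, b)\<in>A. pair a x \<le> b}"
begin

text \<open>Inequalities tight at \<open>x\<close> survive every step in direction \<open>v\<close>;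
  each of the finitely many others has positive slack and allows a short step.\<close>

lemma small_step_in_polyhedron:
  assumes x: "x \<in> P" and v: "\<And>a b. (a, b) \<in> tight A {x} \<Longrightarrow> pair a v \<le> 0"
  shows "\<exists>d>0. \<forall>e. 0 < e \<and> e < d \<longrightarrow> x + e *s v \<in> P"
proof -
  have "\<exists>d>0. \<forall>e. 0 < e \<and> e < d \<longrightarrow> pair (fst c) (x + e *s v) \<le> snd c" if c: "c \<in> A" for c
  proof (cases "pair (fst c) x = snd c")
    case True
    then have "pair (fst c) v \<le> 0" using v[of "fst c" "snd c"] c by (simp add: tight_def split_beta)
    then show ?thesis using True
      by (intro exI[of _ 1]) (auto simp: pair_right_simps mult_nonneg_nonpos)
  next
    case False
    \<comment> \<open>Slack divided by slope; the summand 1 keeps the denominator positive when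
      \<open>v\<close> is orthogonal to the normal.\<close>
    let ?d = "(snd c - pair (fst c) x) / (\<bar>pair (fst c) v\<bar> + 1)"
    have pos: "snd c - pair (fst c) x > 0" using x c False P_eq by (auto simp: order.strict_iff_order)
    have "pair (fst c) (x + e *s v) \<le> snd c" if e: "0 < e" "e < ?d" for e
    proof -
      have "e * pair (fst c) v \<le> e * (\<bar>pair (fst c) v\<bar> + 1)"
        using e(1) by (intro mult_left_mono) auto
      also have "\<dots> \<le> snd c - pair (fst c) x"
        using e(2) by (simp add: field_simps)
      finally show ?thesis by (simp add: pair_right_simps)
    qed
    then show ?thesis using pos by (intro exI[of _ ?d]) auto
  qed
  then obtain d where d: "\<And>c. c \<in> A \<Longrightarrow> d c > 0"
      "\<And>c e. c \<in> A \<Longrightarrow> 0 < e \<Longrightarrow> e < d c \<Longrightarrow> pair (fst c) (x + e *s v) \<le> snd c"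
    by metis
  \<comment> \<open>The inserted 1 provides a step length when \<open>A\<close> is empty.\<close>
  show ?thesis
    using d finite_A unfolding P_eq
    by (intro exI[of _ "Min (insert 1 (d ` A))"]) force
qed

lemma tan_at_polyhedron:
  assumes "x \<in> P"
  shows "tan_at P x = {v. \<forall>(a, b)\<in>tight A {x}. pair a v \<le> 0}"
proof (intro equalityI subsetI)
  fix v assume "v \<in> tan_at P x"
  then obtain d where d: "d > 0" "\<forall>e. 0 < e \<and> e < d \<longrightarrow> x + e *s v \<in> P"
    by (auto simp: tan_at_def)
  then have "x + (d/2) *s v \<in> P" by simp
  then show "v \<in> {v. \<forall>(a, b)\<in>tight A {x}. pair a v \<le> 0}"
    using d(1) unfolding P_eq by (auto simp: tight_def pair_right_simps mult_le_0_iff)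
next
  fix v assume "v \<in> {v. \<forall>(a, b)\<in>tight A {x}. pair a v \<le> 0}"
  then show "v \<in> tan_at P x"
    unfolding tan_at_def using small_step_in_polyhedron[OF assms, of v] by blast
qed

context
  fixes F :: "(rat ^ 'n) set"
  assumes F: "F \<in> faces P"
begin

lemma face_subset: "F \<subseteq> P"
  using F by (auto simp: faces_def)

lemma tight_superset_point: "x \<in> F \<Longrightarrow> tight A F \<subseteq> tight A {x}"
  by (auto simp: tight_def)

text \<open>Each non-tight inequality is strict at some point of \<open>F\<close>. Passing to
  midpoints preserves strictness already achieved and gains one more strict inequality each
  time.\<close>

lemma exists_tight_eq: "\<exists>x\<in>F. tight A {x} = tight A F"
proof -
  obtain \<alpha> \<beta> where ab: "F \<noteq> {}" "F = {x \<in> P. pair \<alpha> x = \<beta>}"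
    using F by (auto simp: faces_def)
  have "\<exists>x\<in>F. \<forall>(a, b)\<in>C. pair a x < b" if "finite C" "C \<subseteq> A - tight A F" for C
    using that
  proof (induction C rule: finite_induct)
    case empty
    then show ?case using ab by auto
  next
    case (insert c C)
    obtain x where x: "x \<in> F" "\<And>a b. (a, b) \<in> C \<Longrightarrow> pair a x < b"
      using insert by auto
    obtain y where y: "y \<in> F" "pair (fst c) y \<noteq> snd c"
      using insert.prems by (force simp: tight_def)
    let ?z = "(1/2) *s x + (1/2) *s y"
    have le: "pair a x \<le> b" "pair a y \<le> b" if "(a, b) \<in> A" for a b
      using x(1) y(1) that face_subset P_eq by auto
    have "?z \<in> F"
      using x(1) y(1) le unfolding ab P_eq by (force simp: pair_right_simps)
    moreover have "pair a ?z < b" if "(a, b) \<in> C" for a b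
      using x(2)[OF that] le(2)[of a b] that insert.prems by (auto simp: pair_right_simps)
    moreover have "pair (fst c) ?z < snd c"
      using y(2) le[of "fst c" "snd c"] insert.prems by (auto simp: pair_right_simps)
    ultimately show ?case by (intro bexI[of _ ?z]) (auto split: prod.splits)
  qed
  from this[of "A - tight A F"] finite_A
  obtain x where x: "x \<in> F" "\<And>a b. (a, b) \<in> A - tight A F \<Longrightarrow> pair a x < b" by blast
  have "tight A {x} \<subseteq> tight A F"
  proof clarify
    fix a b assume ab: "(a, b) \<in> tight A {x}"
    then show "(a, b) \<in> tight A F" using x(2)[of a b] by (auto simp: tight_def)
  qed
  then show ?thesis using x(1) tight_superset_point[OF x(1)] by blast
qed

text \<open>If an inequality is tight at \<open>x\<close> but slack at some \<open>y\<close> in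
  \<open>F\<close>, prolonging the segment from \<open>y\<close> beyond \<open>x\<close> violates
  it. Conversely, if \<open>x\<close> has only the tight inequalities of \<open>F\<close>, their
  normals annihilate \<open>x - y\<close>, so a short prolongation stays in \<open>P\<close>, and in
  \<open>F\<close> because the functional that exposes \<open>F\<close> is constant along
  it.\<close>

lemma rel_int_face: "rel_int F = {x \<in> F. tight A {x} = tight A F}"
proof (intro equalityI subsetI)
  fix x assume x: "x \<in> rel_int F"
  have "pair a y = b" if ab: "(a, b) \<in> tight A {x}" and y: "y \<in> F" for a b y
  proof (rule ccontr)
    assume "pair a y \<noteq> b"
    then have lt: "pair a y < b"
      using ab y face_subset P_eq by (force simp: tight_def)
    obtain e where e: "e > 0" "x + e *s (x - y) \<in> F" using x y by (auto simp: rel_int_def)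
    then have "pair a (x + e *s (x - y)) \<le> b" using ab face_subset P_eq by (auto simp: tight_def)
    then have "e * (b - pair a y) \<le> 0" using ab by (simp add: tight_def pair_right_simps right_diff_distrib)
    then show False using e(1) lt by (simp add: mult_le_0_iff)
  qed
  then show "x \<in> {x \<in> F. tight A {x} = tight A F}"
    using x by (auto simp: tight_def rel_int_def)
next
  obtain \<alpha> \<beta> where ab: "F \<noteq> {}" "F = {x \<in> P. pair \<alpha> x = \<beta>}"
    using F by (auto simp: faces_def)
  fix x assume "x \<in> {x \<in> F. tight A {x} = tight A F}"
  then have x: "x \<in> F" "tight A {x} = tight A F" by auto
  have "\<exists>e>0. x + e *s (x - y) \<in> F" if y: "y \<in> F" for y
  proof -
    have "pair a (x - y) = 0" if "(a, b) \<in> tight A F" for a b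
    proof -
      have "pair a x = b" "pair a y = b" using that x(1) y by (auto simp: tight_def)
      then show ?thesis by (simp add: pair_right_simps)
    qed
    then have "\<exists>d>0. \<forall>e. 0 < e \<and> e < d \<longrightarrow> x + e *s (x - y) \<in> P"
      using x face_subset by (intro small_step_in_polyhedron) auto
    then obtain d where d: "d > 0" "\<And>e. 0 < e \<Longrightarrow> e < d \<Longrightarrow> x + e *s (x - y) \<in> P" by blast
    then have "x + (d/2) *s (x - y) \<in> P" by simp
    then show ?thesis using x(1) y d(1) unfolding ab
      by (intro exI[of _ "d/2"]) (simp add: pair_right_simps)
  qed
  then show "x \<in> rel_int F" using x by (simp add: rel_int_def)
qed

text \<open>The tangent cone is the same at all points of the relative interior, and two such points
  differ by a vector of its lineality space. Hence the union in \<open>supp_cone\<close> collapses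
  to a single translate.\<close>

lemma supp_cone_face:
  assumes x0: "x0 \<in> rel_int F"
  shows "supp_cone P F = (+) x0 ` cone0 (mat 1) (fst ` tight A F)"
proof -
  have tan: "tan_at P x = cone0 (mat 1) (fst ` tight A F)" if "x \<in> rel_int F" for x
  proof -
    have "x \<in> P" "tight A {x} = tight A F" using that rel_int_face face_subset by auto
    then show ?thesis
      by (force simp: tan_at_polyhedron cone0_def quot_space_mat_1)
  qed
  have "x - x0 + v \<in> cone0 (mat 1) (fst ` tight A F)"
    if "x \<in> rel_int F" "v \<in> cone0 (mat 1) (fst ` tight A F)" for x v
  proof -
    have "pair a x = pair a x0" if "(a, b) \<in> tight A F" for a b
      using \<open>x \<in> rel_int F\<close> x0 that by (auto simp: rel_int_def tight_def)
    then show ?thesis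
      using that by (force simp: cone0_def quot_space_mat_1 pair_right_simps)
  qed
  then show ?thesis
    unfolding supp_cone_def using x0 tan
    by (auto intro!: image_eqI[of _ _ "x - x0 + v" for x v]) blast
qed

text \<open>From a relative interior point \<open>x0\<close> a short step away from \<open>y\<close>
  stays in \<open>P\<close>. The functional exposing \<open>F\<close> is maximal at
  \<open>x0\<close>, so it cannot be smaller at \<open>y\<close> than at \<open>x0\<close>.\<close>

lemma face_eq_tight: "F = {x \<in> P. \<forall>(a, b)\<in>tight A F. pair a x = b}"
proof (intro equalityI subsetI)
  fix x assume "x \<in> F"
  then show "x \<in> {x \<in> P. \<forall>(a, b)\<in>tight A F. pair a x = b}"
    using face_subset by (auto simp: tight_def)
next
  obtain \<alpha> \<beta> where ab: "\<And>x. x \<in> P \<Longrightarrow> pair \<alpha> x \<le> \<beta>" "F = {x \<in> P. pair \<alpha> x = \<beta>}"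
    using F by (auto simp: faces_def)
  obtain x0 where x0: "x0 \<in> F" "tight A {x0} = tight A F" using exists_tight_eq by blast
  fix y assume y: "y \<in> {x \<in> P. \<forall>(a, b)\<in>tight A F. pair a x = b}"
  have "pair a (x0 - y) = 0" if "(a, b) \<in> tight A F" for a b
  proof -
    have "pair a x0 = b" "pair a y = b" using that x0(1) y by (auto simp: tight_def)
    then show ?thesis by (simp add: pair_right_simps)
  qed
  then have "\<exists>d>0. \<forall>e. 0 < e \<and> e < d \<longrightarrow> x0 + e *s (x0 - y) \<in> P"
    using x0 face_subset by (intro small_step_in_polyhedron) auto
  then obtain d where d: "d > 0" "\<And>e. 0 < e \<Longrightarrow> e < d \<Longrightarrow> x0 + e *s (x0 - y) \<in> P" by blast
  then have "pair \<alpha> (x0 + (d/2) *s (x0 - y)) \<le> \<beta>" by (intro ab(1)) simp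
  moreover have "pair \<alpha> x0 = \<beta>" using x0(1) ab(2) by auto
  ultimately have "(d/2) * (\<beta> - pair \<alpha> y) \<le> 0"
    by (simp add: pair_right_simps right_diff_distrib)
  then have "\<beta> \<le> pair \<alpha> y" using d(1) by (simp add: mult_le_0_iff)
  then show "y \<in> F" using ab(1)[of y] ab(2) y by auto
qed

end

text \<open>A face is determined by its tight inequalities, a subset of the finite set
  \<open>A\<close>.\<close>

lemma finite_faces_aux: "finite (faces P)"
proof (rule finite_imageD)
  show "finite (tight A ` faces P)"
    by (rule finite_subset[of _ "Pow A"]) (auto simp: tight_def finite_A)
  show "inj_on (tight A) (faces P)"
    proof (rule inj_onI)
    fix F G assume FG: "F \<in> faces P" "G \<in> faces P" "tight A F = tight A G"
    show "F = G" by (subst face_eq_tight[OF FG(1)], subst face_eq_tight[OF FG(2)]) (simp add: FG(3))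
  qed
qed

text \<open>Tight normals take the same value at \<open>z\<close> and at the apex point
  \<open>x0\<close>, so \<open>z - x0\<close> lies in the lineality space and \<open>z\<close> is a
  lattice point of the largest affine subspace of the cone.\<close>

lemma lattice_cone_supp_cone_aux:
  assumes F: "F \<in> faces P" and z: "z \<in> F" "z \<in> int_lattice"
  shows "lattice_cone (mat 1) (supp_cone P F)"
proof -
  obtain x0 where x0: "x0 \<in> rel_int F"
    using exists_tight_eq[OF F] rel_int_face[OF F] by blast
  have "pair a z = pair a x0" if "(a, b) \<in> tight A F" for a b
    using x0 z that by (auto simp: rel_int_def tight_def)
  then have "z - x0 \<in> cone0 (mat 1) (fst ` tight A F)" "x0 - z \<in> cone0 (mat 1) (fst ` tight A F)"
    by (auto simp: cone0_def quot_space_mat_1 pair_right_simps)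
  then have "z \<in> (+) x0 ` (cone0 (mat 1) (fst ` tight A F) \<inter> uminus ` cone0 (mat 1) (fst ` tight A F))"
    by (intro image_eqI[of _ _ "z - x0"]) (auto intro: image_eqI[of _ _ "x0 - z"])
  moreover have "finite (fst ` tight A F)"
    by (rule finite_imageI, rule finite_subset[OF _ finite_A]) (auto simp: tight_def)
  ultimately show ?thesis
    using supp_cone_face[OF F x0] z(2) by (intro lattice_cone_mat_1I)
qed

end

section \<open>Lattice polyhedra and bounded sets in V\<close>

lemma polyhedron_mat_1D:
  assumes "polyhedron_in (mat 1) P"
  obtains A where "finite A" "P = {x. \<forall>(a, b)\<in>A. pair a x \<le> b}"
  using assms by (auto simp: polyhedron_in_def quot_space_mat_1)

lemma finite_faces:
  assumes "polyhedron_in (mat 1) P"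
  shows "finite (faces P)"
proof -
  obtain A where A: "finite A" "P = {x. \<forall>(a, b)\<in>A. pair a x \<le> b}"
    using polyhedron_mat_1D[OF assms] .
  show ?thesis by (rule finite_faces_aux[OF A])
qed

text \<open>Lattice points are only given in minimal faces; as there are finitely many faces, every
  face contains a minimal one.\<close>

lemma lattice_cone_supp_cone:
  assumes P: "lattice_polyhedron (mat 1) P" and F: "F \<in> faces P"
  shows "lattice_cone (mat 1) (supp_cone P F)"
proof -
  have poly: "polyhedron_in (mat 1) P" using P by (simp add: lattice_polyhedron_def)
  obtain A where A: "finite A" "P = {x. \<forall>(a, b)\<in>A. pair a x \<le> b}"
    using polyhedron_mat_1D[OF poly] .
  obtain G where G: "G \<in> faces P" "G \<subseteq> F" "\<And>H. H \<in> faces P \<Longrightarrow> H \<subseteq> G \<Longrightarrow> G = H"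
    using finite_has_minimal2[OF finite_faces[OF poly] F] by meson
  then have "\<forall>H\<in>faces P. \<not> H \<subset> G" by blast
  then have "G \<inter> int_lattice \<noteq> {}"
    using P G(1) unfolding lattice_polyhedron_def quot_lattice_mat_1 by blast
  then obtain z where "z \<in> G" "z \<in> int_lattice" by blast
  then show ?thesis using G(2) by (intro lattice_cone_supp_cone_aux[OF A F]) auto
qed

lemma finite_bounded_int_lattice:
  assumes "bounded_rat P"
  shows "finite (P \<inter> int_lattice)"
proof -
  obtain B where B: "\<And>x i. x \<in> P \<Longrightarrow> \<bar>x $ i\<bar> \<le> B" using assms by (auto simp: bounded_rat_def)
  let ?I = "(of_int ` {-\<lceil>B\<rceil>..\<lceil>B\<rceil>}) :: rat set"
  have "P \<inter> int_lattice \<subseteq> vec_lambda ` (PiE UNIV (\<lambda>_. ?I))"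
  proof
    fix x assume x: "x \<in> P \<inter> int_lattice"
    have "x $ i \<in> ?I" for i
    proof -
      obtain k where k: "x $ i = of_int k" using x by (auto simp: int_lattice_def Ints_def)
      have "\<bar>of_int k :: rat\<bar> \<le> of_int \<lceil>B\<rceil>"
        using B[of x i] x k le_of_int_ceiling[of B] by (metis IntD1 order_trans)
      then have "\<bar>k\<bar> \<le> \<lceil>B\<rceil>" by (metis of_int_abs of_int_le_iff)
      then show ?thesis using k by (simp add: abs_le_iff)
    qed
    then show "x \<in> vec_lambda ` (PiE UNIV (\<lambda>_. ?I))"
      by (intro image_eqI[of _ _ "vec_nth x"]) auto
  qed
  then show ?thesis by (rule finite_subset) (intro finite_imageI finite_PiE; simp)
qed

lemma bounded_not_contains_line:
  assumes "bounded_rat P"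
  shows "\<not> contains_line P"
proof
  obtain B where B: "\<And>x i. x \<in> P \<Longrightarrow> \<bar>x $ i\<bar> \<le> B" using assms by (auto simp: bounded_rat_def)
  assume "contains_line P"
  then obtain x v where xv: "v \<noteq> 0" "\<And>t. x + t *s v \<in> P" by (auto simp: contains_line_def)
  obtain i where i: "v $ i \<noteq> 0" using xv(1) by (auto simp: vec_eq_iff)
  have "\<bar>x $ i + t * v $ i\<bar> \<le> B" for t using B[OF xv(2)[of t], of i] by simp
  \<comment> \<open>This parameter moves the \<open>i\<close>-th coordinate to
    \<open>\<bar>B\<bar> + 1\<close>, beyond the bound.\<close>
  from this[of "(\<bar>B\<bar> + 1 - x $ i) / v $ i"] i show False by simp
qed

lemma bounded_rat_subset: "bounded_rat P \<Longrightarrow> F \<subseteq> P \<Longrightarrow> bounded_rat F"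
  unfolding bounded_rat_def by blast

subsection \<open>The measure on the affine hull\<close>

text \<open>A vector with minimal positive \<open>i\<close>-th coordinate completes a basis of the sublattice on which this
  coordinate vanishes.\<close>

lemma lattice_basis_exists_aux:
  fixes M :: "(rat ^ 'n) set"
  assumes "finite S" "M \<subseteq> int_lattice" "0 \<in> M" "\<And>x y. x \<in> M \<Longrightarrow> y \<in> M \<Longrightarrow> x - y \<in> M"
    and "\<And>x i. x \<in> M \<Longrightarrow> i \<notin> S \<Longrightarrow> x $ i = 0"
  shows "\<exists>B. lattice_basis M B"
  using assms
proof (induction S arbitrary: M rule: finite_induct)
  case empty
  then have "M = {0}" by (auto simp: vec_eq_iff)
  then show ?case
    by (intro exI[of _ "{}"]) (auto simp: lattice_basis_def vec.independent_empty)
next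
  case (insert i S)
  define N where "N = {x \<in> M. x $ i = 0}"
  have "\<exists>B. lattice_basis N B"
  proof (rule insert.IH)
    show "x $ j = 0" if "x \<in> N" "j \<notin> S" for x j
      using that insert.prems(4)[of x j] by (cases "j = i") (auto simp: N_def)
  qed (use insert.prems in \<open>auto simp: N_def\<close>)
  then obtain B where B: "finite B" "B \<subseteq> N" "vec.independent B"
      "N = {\<Sum>b\<in>B. of_int (c b) *s b |c. True}"
    by (auto simp: lattice_basis_def)
  have int: "\<exists>k. x $ i = of_int k" if "x \<in> M" for x
  proof -
    have "x $ i \<in> \<int>" using that insert.prems(1) by (auto simp: int_lattice_def)
    then show ?thesis by (auto elim: Ints_cases)
  qed
  have neg: "- x \<in> M" if "x \<in> M" for x
    using insert.prems(3)[OF insert.prems(2) that] by simp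
  have add: "x + y \<in> M" if "x \<in> M" "y \<in> M" for x y
    using insert.prems(3)[OF that(1) neg[OF that(2)]] by simp
  have mult_nat: "of_nat n *s x \<in> M" if "x \<in> M" for x n
    using that insert.prems(2) by (induction n) (auto intro!: add simp: distrib_right vec.scale_left_distrib)
  have mult: "of_int q *s x \<in> M" if "x \<in> M" for x q
  proof (cases q rule: int_cases2)
    case (nonneg n)
    then show ?thesis using mult_nat[OF that, of n] by simp
  next
    case (nonpos n)
    then show ?thesis using neg[OF mult_nat[OF that, of n]] by simp
  qed
  show ?case
  proof (cases "\<exists>x\<in>M. x $ i \<noteq> 0")
    case False
    then have "N = M" by (auto simp: N_def)
    then show ?thesis using \<open>\<exists>B. lattice_basis N B\<close> by simp
  next
    case True
    define Q where "Q k \<longleftrightarrow> k > 0 \<and> (\<exists>x\<in>M. x $ i = of_nat k)" for k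
    obtain x0 k0 where x0: "x0 \<in> M" "x0 $ i = of_int k0" "k0 \<noteq> 0" using True int by force
    \<comment> \<open>\<open>M\<close> is closed under negation, so a nonzero \<open>i\<close>-th
      coordinate yields a positive one.\<close>
    have "Q (nat \<bar>k0\<bar>)"
      using x0 neg[OF x0(1)] unfolding Q_def
      by (cases "k0 > 0") (auto intro: bexI[of _ x0] bexI[of _ "- x0"])
    then have Qd: "Q (LEAST k. Q k)" and least: "\<And>k. Q k \<Longrightarrow> (LEAST k. Q k) \<le> k"
      by (auto intro: LeastI Least_le)
    define d where "d = (LEAST k. Q k)"
    obtain m where m: "m \<in> M" "m $ i = of_nat d" and "d > 0"
      using Qd by (auto simp: Q_def d_def)
    have "vec.span B \<subseteq> {x. x $ i = 0}"
      using B(2) by (intro vec.span_minimal) (auto simp: N_def vec.subspace_def)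
    then have m_notin: "m \<notin> vec.span B" using m \<open>d > 0\<close> by auto
    then have "m \<notin> B" using vec.span_base by blast
    have ind: "vec.independent (insert m B)"
      using m_notin B(3) by (simp add: vec.independent_insert)
    have "x \<in> {\<Sum>b\<in>insert m B. of_int (c b) *s b |c. True}" if x: "x \<in> M" for x
    proof -
      obtain k where k: "x $ i = of_int k" using int[OF x] by blast
      \<comment> \<open>Euclidean division by the least positive coordinate: a nonzero remainder
        would be a smaller positive coordinate in \<open>M\<close>.\<close>
      define q r where "q = k div int d" "r = k mod int d"
      have kqr: "k = q * int d + r" and r: "0 \<le> r" "r < int d"
        using \<open>d > 0\<close> by (auto simp: q_r_def)
      let ?y = "x - of_int q *s m"
      have y: "?y \<in> M" using insert.prems(3)[OF x mult[OF m(1)]] .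
      have yi: "?y $ i = of_int r" using k m(2) kqr by simp
      have "r = 0"
      proof (rule ccontr)
        assume "r \<noteq> 0"
        then have "Q (nat r)" using y yi r unfolding Q_def by (auto intro!: bexI[of _ ?y])
        then have "d \<le> nat r" using least by (simp add: d_def)
        then show False using r \<open>r \<noteq> 0\<close> by linarith
      qed
      then have "?y \<in> N" using y yi by (simp add: N_def)
      then obtain c where "?y = (\<Sum>b\<in>B. of_int (c b) *s b)" unfolding B(4) by auto
      also have "\<dots> = (\<Sum>b\<in>B. of_int ((c(m := q)) b) *s b)"
        using \<open>m \<notin> B\<close> by (intro sum.cong) auto
      finally have "x = (\<Sum>b\<in>insert m B. of_int ((c(m := q)) b) *s b)"
        using B(1) \<open>m \<notin> B\<close> by (simp add: algebra_simps)
      then show ?thesis by blast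
    qed
    moreover have "(\<Sum>b\<in>C. of_int (c b) *s b) \<in> M" if "C \<subseteq> insert m B" for c C
      using that B(2) m(1) insert.prems(2) by (induction C rule: infinite_finite_induct)
        (auto intro!: add mult simp: N_def)
    ultimately have "lattice_basis M (insert m B)"
      using B(1,2) m(1) ind by (auto simp: lattice_basis_def N_def)
    then show ?thesis by blast
  qed
qed

text \<open>\<open>aff_measure\<close> picks its basis with \<open>SOME\<close>; this guarantees
  that the choice is a genuine basis.\<close>

lemma lattice_basis_exists: "\<exists>B. lattice_basis (int_lattice \<inter> lin P) B"
proof (rule lattice_basis_exists_aux[of UNIV])
  show "x - y \<in> int_lattice \<inter> lin P" if "x \<in> int_lattice \<inter> lin P" "y \<in> int_lattice \<inter> lin P" for x y
    using that by (auto simp: int_lattice_def lin_def intro: vec.span_diff)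
qed (auto simp: int_lattice_def lin_def vec.span_zero)

text \<open>The dual functional is one component, with arbitrary index \<open>k\<close>, of an
  endomorphism that sends \<open>b\<close> to the \<open>k\<close>-th unit vector and the rest of
  \<open>B\<close> to 0; it is a row of the matrix.\<close>

lemma dual_vectors_exist:
  fixes B :: "(rat ^ 'n) set"
  assumes "vec.independent B" "b \<in> B"
  shows "\<exists>u. \<forall>b'\<in>B. pair u b' = (if b' = b then 1 else 0)"
proof -
  obtain k :: 'n where True by blast
  obtain g where g: "Vector_Spaces.linear (*s) (*s) g"
      "\<And>x. x \<in> B \<Longrightarrow> g x = (if x = b then axis k 1 else 0 :: rat ^ 'n)"
    using vec.linear_independent_extend[OF assms(1), of "\<lambda>x. if x = b then axis k 1 else 0"] by blast
  have "pair (matrix g $ k) x = g x $ k" for x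
    by (simp add: matrix_works[OF g(1), symmetric] matrix_vector_mult_def pair_def)
  then show ?thesis using g(2) by (intro exI[of _ "matrix g $ k"]) (auto simp: axis_def)
qed

lemma pair_emb: "pair (emb x) (emb y) = of_rat (pair x y)"
  by (simp add: pair_def emb_def of_rat_sum of_rat_mult)

lemma pair_scaleR_right: "pair a (c *\<^sub>R x) = c * pair a x" for a x :: "real ^ 'n"
  by (simp add: pair_def sum_distrib_left mult_ac)

lemma pair_sum_right: "pair a (\<Sum>x\<in>X. f x) = (\<Sum>x\<in>X. pair a (f x))"
  by (induction X rule: infinite_finite_induct) (auto simp: pair_def distrib_left sum.distrib)

lemma sets_aff_measure: "sets (aff_measure Q P) = sets borel"
  by (simp add: aff_measure_def Let_def)

text \<open>Dual vectors recover the parameters \<open>t b\<close> as continuous functions of the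
  point. On a compact set they are bounded, so the preimage under the parametrization lies in a box
  of finite Lebesgue measure.\<close>

lemma emeasure_aff_measure_compact:
  fixes P :: "(rat ^ 'n) set"
  assumes K: "compact K"
  shows "emeasure (aff_measure (mat 1) P) K < \<infinity>"
proof -
  define p where "p = (SOME p. p \<in> P)"
  define B where "B = (SOME B. lattice_basis (int_lattice \<inter> lin P) B)"
  have "lattice_basis (int_lattice \<inter> lin P) B"
    unfolding B_def using lattice_basis_exists by (rule someI_ex)
  then have B: "finite B" "vec.independent B" by (auto simp: lattice_basis_def)
  define T :: "(rat ^ 'n \<Rightarrow> real) \<Rightarrow> real ^ 'n" where "T t = emb p + (\<Sum>b\<in>B. t b *\<^sub>R emb b)" for t
  let ?L = "\<Pi>\<^sub>M b\<in>B. (lborel :: real measure)"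
  have M: "aff_measure (mat 1) P = distr ?L borel T"
    unfolding aff_measure_def Let_def quot_lattice_mat_1 T_def p_def B_def by (rule refl)
  have T: "T \<in> measurable ?L borel"
    unfolding T_def by measurable
  have "\<forall>b\<in>B. \<exists>u. \<forall>b'\<in>B. pair u b' = (if b' = b then 1 else 0)"
    using dual_vectors_exist[OF B(2)] by blast
  then obtain u where u: "\<And>b b'. b \<in> B \<Longrightarrow> b' \<in> B \<Longrightarrow> pair (u b) b' = (if b' = b then 1 else 0)"
    by metis
  have coord: "t b = pair (emb (u b)) (T t) - pair (emb (u b)) (emb p)" if b: "b \<in> B" for b t
  proof -
    have "pair (emb (u b)) (T t) - pair (emb (u b)) (emb p) = (\<Sum>b'\<in>B. t b' * of_rat (pair (u b) b'))"
      by (simp add: T_def pair_add_right pair_sum_right pair_scaleR_right pair_emb)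
    also have "\<dots> = (\<Sum>b'\<in>B. if b' = b then t b' else 0)"
      using u[OF b] by (intro sum.cong) auto
    finally show ?thesis using B(1) b by simp
  qed
  have "\<exists>C. \<forall>x\<in>K. \<bar>pair (emb (u b)) x - pair (emb (u b)) (emb p)\<bar> \<le> C" for b
  proof -
    have "compact ((\<lambda>x. pair (emb (u b)) x - pair (emb (u b)) (emb p :: real ^ 'n)) ` K)"
      unfolding pair_def by (intro compact_continuous_image continuous_intros K)
    then show ?thesis
      using compact_imp_bounded bounded_iff by (metis (no_types, lifting) image_eqI real_norm_def)
  qed
  then obtain C where C: "\<And>b x. x \<in> K \<Longrightarrow> \<bar>pair (emb (u b)) x - pair (emb (u b)) (emb p)\<bar> \<le> C b"
    by metis
  interpret product_sigma_finite "\<lambda>_ :: rat ^ 'n. lborel :: real measure"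
    by (rule product_sigma_finite.intro) (rule sigma_finite_lborel)
  have "emeasure (aff_measure (mat 1) P) K = emeasure ?L (T -` K \<inter> space ?L)"
    unfolding M using T K by (intro emeasure_distr) (auto intro: borel_compact)
  also have "\<dots> \<le> emeasure ?L (PiE B (\<lambda>b. {- C b..C b}))"
  proof (rule emeasure_mono)
    show "T -` K \<inter> space ?L \<subseteq> PiE B (\<lambda>b. {- C b..C b})"
    proof
      fix t assume t: "t \<in> T -` K \<inter> space ?L"
      have "\<bar>t b\<bar> \<le> C b" if "b \<in> B" for b
        using C[of "T t" b] coord[OF that, of t] t by simp
      then have "- C b \<le> t b" "t b \<le> C b" if "b \<in> B" for b
        using that by (auto simp: abs_le_iff minus_le_iff)
      then show "t \<in> PiE B (\<lambda>b. {- C b..C b})"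
        using t by (auto simp: space_PiM PiE_def)
    qed
    show "PiE B (\<lambda>b. {- C b..C b}) \<in> sets ?L"
      using B(1) by (intro sets_PiM_I_finite) auto
  qed
  also have "\<dots> = (\<Prod>b\<in>B. emeasure lborel {- C b..C b})"
    using B(1) by (intro emeasure_PiM) auto
  also have "\<dots> < \<infinity>"
    by (simp add: emeasure_lborel_Icc_eq ennreal_prod_eq_top less_top[symmetric])
  finally show ?thesis .
qed

lemma compact_real_hull:
  assumes "bounded_rat P"
  shows "compact (real_hull P)"
proof -
  obtain B where B: "\<And>x i. x \<in> P \<Longrightarrow> \<bar>x $ i\<bar> \<le> B" using assms by (auto simp: bounded_rat_def)
  have "norm (emb x :: real ^ 'a) \<le> (\<Sum>i\<in>(UNIV :: 'a set). of_rat B)" if "x \<in> P" for x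
  proof -
    have "norm (emb x :: real ^ 'a) \<le> (\<Sum>i\<in>UNIV. \<bar>emb x $ i\<bar>)" by (rule norm_le_l1_cart)
    also have "\<dots> \<le> (\<Sum>i\<in>(UNIV :: 'a set). of_rat B)"
    proof (rule sum_mono)
      fix i
      have "of_rat (- B) \<le> (of_rat (x $ i) :: real)" "of_rat (x $ i) \<le> (of_rat B :: real)"
        using B[OF that, of i] unfolding of_rat_less_eq by auto
      then show "\<bar>emb x $ i\<bar> \<le> (of_rat B :: real)" unfolding emb_def of_rat_minus vec_lambda_beta by linarith
    qed
    finally show ?thesis .
  qed
  then have "bounded (emb ` P :: (real ^ 'a) set)" by (auto simp: bounded_iff)
  then show ?thesis by (simp add: real_hull_def)
qed

subsection \<open>Fourier-Laplace transforms over compact sets\<close>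

lemma norm_pair_le:
  fixes \<xi> x :: "complex ^ 'n"
  assumes "\<And>i. norm (x $ i) \<le> R"
  shows "norm (pair \<xi> x) \<le> norm \<xi> * (real CARD('n) * R)"
proof -
  have "norm (pair \<xi> x) \<le> (\<Sum>i\<in>UNIV. norm (\<xi> $ i * x $ i))"
    unfolding pair_def by (rule norm_sum)
  also have "\<dots> \<le> (\<Sum>i\<in>(UNIV :: 'n set). norm \<xi> * R)"
    unfolding norm_mult using assms
    by (intro sum_mono mult_mono Finite_Cartesian_Product.norm_nth_le) auto
  finally show ?thesis by (simp add: mult_ac)
qed

lemma continuous_on_pair_cvec: "continuous_on S (\<lambda>x. pair \<xi> (cvec x))"
  unfolding pair_def cvec_def vec_lambda_beta by (intro continuous_intros)

lemma continuous_on_mpow_cvec: "continuous_on S (\<lambda>x. mpow (cvec x) \<alpha>)"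
  unfolding mpow_def cvec_def vec_lambda_beta by (intro continuous_intros)

lemma pair_scale_left: "pair (c *s a) x = c * pair a x"
  by (simp add: pair_def sum_distrib_left mult_ac)

lemma pair_add_left: "pair (a + b) x = pair a x + pair b x"
  by (simp add: pair_def distrib_right sum.distrib)

context
  fixes M :: "(real ^ 'n) measure" and K :: "(real ^ 'n) set"
  assumes sets_M: "sets M = sets borel" and K: "compact K" and emeasure_K: "emeasure M K < \<infinity>"
begin

lemma K_sets: "K \<in> sets M"
  using K by (simp add: sets_M borel_compact)

lemma set_integrable_continuous:
  fixes f :: "real ^ 'n \<Rightarrow> 'b::{banach, second_countable_topology}"
  assumes f: "continuous_on UNIV f"
  shows "set_integrable M K f"
proof -
  have "compact (f ` K)" using K f by (intro compact_continuous_image) (auto intro: continuous_on_subset)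
  then obtain B where B: "\<And>x. x \<in> K \<Longrightarrow> norm (f x) \<le> B"
    using compact_imp_bounded bounded_iff by (metis imageI)
  have "f \<in> borel_measurable M"
    using borel_measurable_continuous_onI[OF f] measurable_cong_sets[OF sets_M refl] by blast
  then show ?thesis
    unfolding set_integrable_def
    using K_sets emeasure_K B by (intro integrableI_bounded_set_indicator[where B = B]) auto
qed

lemma norm_set_integral_le:
  fixes f :: "real ^ 'n \<Rightarrow> 'b::{banach, second_countable_topology}"
  assumes f: "set_integrable M K f" and le: "\<And>x. x \<in> K \<Longrightarrow> norm (f x) \<le> c"
  shows "norm (LINT x:K|M. f x) \<le> c * measure M K"
proof -
  have "norm (LINT x:K|M. f x) \<le> (LINT x:K|M. norm (f x))"
    using f by (rule set_integral_norm_bound)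
  also have "\<dots> \<le> (LINT x:K|M. c)"
    using le by (rule set_integral_mono[OF set_integrable_norm[OF f] set_integrable_continuous[OF continuous_on_const]])
  also have "\<dots> = c * measure M K"
    by (simp add: set_lebesgue_integral_def K_sets)
  finally show ?thesis .
qed

text \<open>Stated for an arbitrary filter because multi-index partial sums run along
  \<open>finite_subsets_at_top\<close>; uniform convergence on a set of finite measure
  suffices.\<close>

lemma set_integral_uniform_limit:
  fixes f :: "'i \<Rightarrow> real ^ 'n \<Rightarrow> 'b::{banach, second_countable_topology}"
  assumes lim: "uniform_limit K f l F"
    and f: "\<And>i. set_integrable M K (f i)" and l: "set_integrable M K l"
  shows "((\<lambda>i. LINT x:K|M. f i x) \<longlongrightarrow> (LINT x:K|M. l x)) F"
proof (rule tendstoI)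
  fix e :: real assume e: "e > 0"
  \<comment> \<open>The summand 1 covers the case that \<open>K\<close> has measure 0.\<close>
  define e' where "e' = e / (measure M K + 1)"
  have e': "e' > 0" using e by (simp add: e'_def add_nonneg_pos)
  have "\<forall>\<^sub>F i in F. \<forall>x\<in>K. dist (f i x) (l x) < e'"
    using lim e' by (auto simp: uniform_limit_iff)
  then show "\<forall>\<^sub>F i in F. dist (LINT x:K|M. f i x) (LINT x:K|M. l x) < e"
  proof eventually_elim
    case (elim i)
    have "dist (LINT x:K|M. f i x) (LINT x:K|M. l x) = norm (LINT x:K|M. f i x - l x)"
      using f l by (simp add: dist_norm set_integral_diff)
    also have "\<dots> \<le> e' * measure M K"
      using elim f l by (intro norm_set_integral_le set_integral_diff) (auto simp: dist_norm intro: less_imp_le)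
    also have "\<dots> < e' * (measure M K + 1)" using e' by simp
    also have "\<dots> = e"
      using measure_nonneg[of M K] unfolding e'_def by (simp add: add_nonneg_eq_0_iff)
    finally show ?case .
  qed
qed

lemma K_bounded: "\<exists>R\<ge>0. \<forall>x\<in>K. \<forall>i. norm (cvec x $ i) \<le> R"
proof -
  obtain R where R: "\<And>x. x \<in> K \<Longrightarrow> norm x \<le> R"
    using K compact_imp_bounded bounded_iff by metis
  have "norm (cvec x $ i) \<le> max R 0" if "x \<in> K" for x i
    using R[OF that] Finite_Cartesian_Product.norm_nth_le[of x i] by (simp add: cvec_def)
  then show ?thesis by (intro exI[of _ "max R 0"]) auto
qed

lemma set_integrable_exp_pair: "set_integrable M K (\<lambda>x. exp (pair \<xi> (cvec x)))"
  by (intro set_integrable_continuous continuous_on_exp continuous_on_pair_cvec)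

text \<open>The exponential series converges uniformly for \<open>x\<close> in \<open>K\<close> and
  is integrated term by term, so the Taylor coefficients are the moments of \<open>K\<close> divided
  by \<alpha>!.\<close>

lemma has_taylor_set_integral_exp:
  "has_taylor (\<lambda>\<xi>. LINT x:K|M. exp (pair \<xi> (cvec x)))
     (\<lambda>\<alpha>. (LINT x:K|M. mpow (cvec x) \<alpha>) / of_nat (mfact \<alpha>))"
proof -
  obtain R where R: "R \<ge> 0" "\<And>x i. x \<in> K \<Longrightarrow> norm (cvec x $ i) \<le> R" using K_bounded by blast
  have "((\<lambda>\<alpha>. (LINT x:K|M. mpow (cvec x) \<alpha>) / of_nat (mfact \<alpha>) * mpow \<xi> \<alpha>)
      has_sum (LINT x:K|M. exp (pair \<xi> (cvec x)))) UNIV" for \<xi>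
  proof -
    define t where "t \<alpha> x = mpow (cvec x) \<alpha> / of_nat (mfact \<alpha>) * mpow \<xi> \<alpha>" for \<alpha> and x :: "real ^ 'n"
    have "uniform_limit K (\<lambda>X x. \<Sum>\<alpha>\<in>X. t \<alpha> x) (\<lambda>x. exp (pair \<xi> (cvec x))) (finite_subsets_at_top UNIV)"
    proof (rule Weierstrass_m_test_general')
      \<comment> \<open>\<open>R\<close> bounds all coordinates on \<open>K\<close>, so the series
        at this corner point is a majorant.\<close>
      let ?e = "\<chi> i. complex_of_real R"
      show "(\<lambda>\<alpha>. norm (mpow ?e \<alpha> / of_nat (mfact \<alpha>) * mpow \<xi> \<alpha>)) summable_on UNIV"
        using has_sum_imp_summable[OF exp_pair_has_sum[of ?e \<xi>]]
        by (rule iffD1[OF summable_on_iff_abs_summable_on_complex])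
      show "norm (t \<alpha> x) \<le> norm (mpow ?e \<alpha> / of_nat (mfact \<alpha>) * mpow \<xi> \<alpha>)" if "x \<in> K" for \<alpha> x
      proof -
        have "norm (mpow (cvec x) \<alpha>) \<le> norm (mpow ?e \<alpha>)"
          unfolding norm_mpow using R(1) R(2)[OF that] by (intro prod_mono conjI power_mono) auto
        then show ?thesis unfolding t_def norm_mult norm_divide by (intro mult_right_mono divide_right_mono) auto
      qed
      show "((\<lambda>\<alpha>. t \<alpha> x) has_sum exp (pair \<xi> (cvec x))) UNIV" for x
        unfolding t_def by (rule exp_pair_has_sum)
    qed
    then have lim: "((\<lambda>X. LINT x:K|M. \<Sum>\<alpha>\<in>X. t \<alpha> x) \<longlongrightarrow> (LINT x:K|M. exp (pair \<xi> (cvec x)))) (finite_subsets_at_top UNIV)"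
      unfolding t_def
      by (intro set_integral_uniform_limit set_integrable_continuous continuous_intros
          continuous_on_pair_cvec continuous_on_mpow_cvec) (auto simp: mfact_def)
    have eq: "(LINT x:K|M. \<Sum>\<alpha>\<in>X. t \<alpha> x)
        = (\<Sum>\<alpha>\<in>X. (LINT x:K|M. mpow (cvec x) \<alpha>) / of_nat (mfact \<alpha>) * mpow \<xi> \<alpha>)" if "finite X" for X
    proof -
      have "set_integrable M K (t \<alpha>)" for \<alpha>
        unfolding t_def by (intro set_integrable_continuous continuous_intros
          continuous_on_pair_cvec continuous_on_mpow_cvec) (auto simp: mfact_def)
      then have "(LINT x:K|M. \<Sum>\<alpha>\<in>X. t \<alpha> x) = (\<Sum>\<alpha>\<in>X. LINT x:K|M. t \<alpha> x)"
        unfolding set_integrable_def set_lebesgue_integral_def scaleR_sum_right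
        by (intro Bochner_Integration.integral_sum) auto
      moreover have "(LINT x:K|M. t \<alpha> x) = (LINT x:K|M. mpow (cvec x) \<alpha>) / of_nat (mfact \<alpha>) * mpow \<xi> \<alpha>" for \<alpha>
        using set_integral_mult_right[of M K "mpow \<xi> \<alpha> / of_nat (mfact \<alpha>)" "\<lambda>x. mpow (cvec x) \<alpha>"]
        by (simp add: t_def mult_ac)
      ultimately show ?thesis by simp
    qed
    show ?thesis
      unfolding has_sum_def
      by (rule Lim_transform_eventually[OF lim]) (auto simp: eq intro!: eventually_finite_subsets_at_top_weakI)
  qed
  then show ?thesis unfolding has_taylor_mpow by (intro exI[of _ 1]) auto
qed

text \<open>Differentiation under the integral sign with an explicit quadratic remainder. It is
  needed to place the integral among the meromorphic functions from which
  \<open>exp_integral\<close> is selected.\<close>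

lemma holo_at_set_integral_exp: "holo_at UNIV (\<lambda>\<xi>. LINT x:K|M. exp (pair \<xi> (cvec x))) z"
proof -
  obtain R where R: "R \<ge> 0" "\<And>x i. x \<in> K \<Longrightarrow> norm (cvec x $ i) \<le> R" using K_bounded by blast
  define I where "I \<xi> = (LINT x:K|M. exp (pair \<xi> (cvec x)))" for \<xi>
  have "\<exists>f'. (I has_derivative f') (at w) \<and> (\<forall>c v. f' (c *s v) = c * f' v)" for w
  proof -
    define L where "L \<eta> = (LINT x:K|M. pair \<eta> (cvec x) * exp (pair w (cvec x)))" for \<eta>
    have int: "set_integrable M K (\<lambda>x. pair \<eta> (cvec x) * exp (pair \<zeta> (cvec x)))" for \<eta> \<zeta>
      by (intro set_integrable_continuous continuous_on_exp continuous_on_pair_cvec continuous_intros)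
    have L_scale: "L (c *s v) = c * L v" for c v
      by (simp add: L_def pair_scale_left mult.assoc)
    have L_add: "L (u + v) = L u + L v" for u v
      using int by (simp add: L_def pair_add_left distrib_right set_integral_add)
    \<comment> \<open>Derivatives are taken over the reals, so real linearity is extracted from the
      complex one.\<close>
    have "L (c *\<^sub>R v) = c *\<^sub>R L v" for c v
    proof -
      have "c *\<^sub>R v = complex_of_real c *s v" 
        unfolding vec_eq_iff vector_scaleR_component vector_smult_component by (simp add: scaleR_conv_of_real)
      then show ?thesis by (simp add: L_scale scaleR_conv_of_real)
    qed
    with L_add have "linear L" by (rule linearI)
    then have L: "bounded_linear L" by (simp add: linear_conv_bounded_linear)
    define N where "N = real CARD('n) * R"
    have N: "N \<ge> 0" using R(1) by (simp add: N_def)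
    have pairN: "norm (pair \<eta> (cvec x)) \<le> norm \<eta> * N" if "x \<in> K" for \<eta> x
      unfolding N_def using R(2)[OF that] by (rule norm_pair_le)
    \<comment> \<open>For increments \<eta> of norm below 1 the pairing p with \<open>x\<close>
      satisfies \<bar>p\<bar> \<le> \<open>N\<close>, and the remainder exp p - 1 - p is at most
      \<open>exp N\<close> times the square of \<bar>\<eta>\<bar> \<open>N\<close>. The other
      factors bound exp <w, x> and integrate over \<open>K\<close>.\<close>
    define C where "C = exp (norm w * N) * (exp N * N\<^sup>2) * measure M K"
    have "(I has_derivative L) (at w within UNIV)"
      using _ L
    proof (rule has_derivativeI_sandwich)
      show "(0::real) < 1" by simp
      fix y assume y: "y \<noteq> w" "dist y w < 1"
      define \<eta> where "\<eta> = y - w"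
      have \<eta>: "norm \<eta> < 1" "norm \<eta> > 0" "y = w + \<eta>" using y by (auto simp: \<eta>_def dist_norm)
      have "I y - I w - L \<eta> = (LINT x:K|M. exp (pair y (cvec x)) - exp (pair w (cvec x)) - pair \<eta> (cvec x) * exp (pair w (cvec x)))"
        unfolding I_def L_def
        using set_integrable_exp_pair int by (simp add: set_integral_diff)
      also have "norm \<dots> \<le> exp (norm w * N) * (exp N * (N\<^sup>2 * (norm \<eta>)\<^sup>2)) * measure M K"
      proof (rule norm_set_integral_le)
        show "set_integrable M K (\<lambda>x. exp (pair y (cvec x)) - exp (pair w (cvec x)) - pair \<eta> (cvec x) * exp (pair w (cvec x)))"
          using set_integrable_exp_pair int by (intro set_integral_diff)
        fix x assume x: "x \<in> K"
        define p q where "p = pair \<eta> (cvec x)" and "q = pair w (cvec x)"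
        have p: "norm p \<le> norm \<eta> * N" and q: "norm q \<le> norm w * N"
          using pairN[OF x] by (auto simp: p_def q_def)
        have "norm p \<le> N" using p \<eta>(1) N mult_right_mono[of "norm \<eta>" 1 N] by linarith
        have "norm (exp p - (\<Sum>k\<le>1. p ^ k / fact k)) \<le> exp \<bar>Re p\<bar> * norm p ^ Suc 1 / fact 1"
          by (rule Taylor_exp)
        then have "norm (exp p - 1 - p) \<le> exp \<bar>Re p\<bar> * (norm p)\<^sup>2"
          by (simp add: power2_eq_square algebra_simps)
        also have "\<dots> \<le> exp N * (norm \<eta> * N)\<^sup>2"
          using p \<open>norm p \<le> N\<close> abs_Re_le_cmod[of p] by (intro mult_mono power_mono) auto
        finally have 1: "norm (exp p - 1 - p) \<le> exp N * (norm \<eta> * N)\<^sup>2" .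
        have "exp (pair y (cvec x)) - exp q - p * exp q = exp q * (exp p - 1 - p)"
          by (simp add: \<eta>(3) pair_add_left exp_add algebra_simps p_def q_def)
        then have "norm (exp (pair y (cvec x)) - exp q - p * exp q) = norm (exp q) * norm (exp p - 1 - p)"
          by (simp add: norm_mult)
        also have "\<dots> \<le> exp (norm w * N) * (exp N * (norm \<eta> * N)\<^sup>2)"
          using 1 q norm_exp[of q] by (intro mult_mono) (auto intro: order_trans)
        finally show "norm (exp (pair y (cvec x)) - exp (pair w (cvec x)) - pair \<eta> (cvec x) * exp (pair w (cvec x)))
          \<le> exp (norm w * N) * (exp N * (N\<^sup>2 * (norm \<eta>)\<^sup>2))"
          by (simp add: p_def q_def power_mult_distrib mult_ac)
      qed
      finally have "norm (I y - I w - L \<eta>) \<le> C * norm \<eta> * norm \<eta>"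
        by (simp add: C_def power2_eq_square mult_ac)
      then show "norm (I y - I w - L (y - w)) / norm (y - w) \<le> C * norm (y - w)"
        using \<eta>(2) by (simp add: \<eta>_def divide_le_eq)
    next
      have "((\<lambda>y. C * norm (y - w)) \<longlongrightarrow> C * norm (w - w)) (at w within UNIV)"
        by (intro tendsto_intros)
      then show "((\<lambda>y. C * norm (y - w)) \<longlongrightarrow> 0) (at w within UNIV)" by simp
    qed
    then show ?thesis using L_scale by auto
  qed
  then show ?thesis
    unfolding holo_at_def I_def[symmetric, abs_def] by (intro exI[of _ 1]) auto
qed

end

subsection \<open>Differential operators on polynomials\<close>

lemma mpow_cvec_line:
  "mpow (cvec (x + t *\<^sub>R axis i 1)) \<gamma> =
     complex_of_real ((x $ i + t) ^ \<gamma> i) * (\<Prod>j\<in>UNIV - {i}. cvec x $ j ^ \<gamma> j)"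
proof -
  have "mpow (cvec (x + t *\<^sub>R axis i 1)) \<gamma> =
      cvec (x + t *\<^sub>R axis i 1) $ i ^ \<gamma> i * (\<Prod>j\<in>UNIV - {i}. cvec (x + t *\<^sub>R axis i 1) $ j ^ \<gamma> j)"
    unfolding mpow_def by (subst prod.remove[of _ i]) auto
  also have "(\<Prod>j\<in>UNIV - {i}. cvec (x + t *\<^sub>R axis i 1) $ j ^ \<gamma> j) = (\<Prod>j\<in>UNIV - {i}. cvec x $ j ^ \<gamma> j)"
    by (intro prod.cong) (auto simp: cvec_def axis_def)
  finally show ?thesis by (simp add: cvec_def axis_def)
qed

text \<open>If \<open>\<gamma> i = 0\<close> the truncated exponent is harmless, since the factor
  \<open>\<gamma> i\<close> vanishes.\<close>

lemma mpow_has_vector_derivative: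
  "((\<lambda>t. mpow (cvec (x + t *\<^sub>R axis i 1)) \<gamma>) has_vector_derivative
     of_nat (\<gamma> i) * mpow (cvec x) (\<gamma>(i := \<gamma> i - 1))) (at 0)"
proof -
  define Q where "Q = (\<Prod>j\<in>UNIV - {i}. cvec x $ j ^ \<gamma> j)"
  have "mpow (cvec x) (\<gamma>(i := \<gamma> i - 1)) = complex_of_real ((x $ i) ^ (\<gamma> i - 1)) * Q"
    using mpow_cvec_line[of x 0 i "\<gamma>(i := \<gamma> i - 1)"] by (simp add: Q_def)
  moreover have "((\<lambda>t. (x $ i + t) ^ \<gamma> i) has_real_derivative (of_nat (\<gamma> i) * (x $ i) ^ (\<gamma> i - 1))) (at 0)"
    by (auto intro!: derivative_eq_intros)
  then have "((\<lambda>t. complex_of_real ((x $ i + t) ^ \<gamma> i) * Q) has_vector_derivative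
      complex_of_real (of_nat (\<gamma> i) * (x $ i) ^ (\<gamma> i - 1)) * Q) (at 0)"
    by (intro has_vector_derivative_mult_left has_vector_derivative_of_real)
  ultimately show ?thesis
    unfolding mpow_cvec_line Q_def[symmetric] by (simp add: mult.assoc)
qed

text \<open>Indexing the terms by \<open>k\<close> makes the form stable under differentiation: only
  coefficients and exponents change, and no terms have to be collected.\<close>

lemma partial_poly:
  "partial i (\<lambda>x. \<Sum>k\<in>G. c k * mpow (cvec x) (e k)) =
     (\<lambda>x. \<Sum>k\<in>G. c k * of_nat (e k i) * mpow (cvec x) ((e k)(i := e k i - 1)))"
proof
  fix x
  have "((\<lambda>t. \<Sum>k\<in>G. c k * mpow (cvec (x + t *\<^sub>R axis i 1)) (e k)) has_vector_derivative
      (\<Sum>k\<in>G. c k * (of_nat (e k i) * mpow (cvec x) ((e k)(i := e k i - 1))))) (at 0)"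
    by (intro has_vector_derivative_sum has_vector_derivative_mult_right mpow_has_vector_derivative)
  then show "partial i (\<lambda>x. \<Sum>k\<in>G. c k * mpow (cvec x) (e k)) x =
      (\<Sum>k\<in>G. c k * of_nat (e k i) * mpow (cvec x) ((e k)(i := e k i - 1)))"
    unfolding partial_def by (simp add: vector_derivative_at mult.assoc)
qed

text \<open>\<open>fact k * (n choose k)\<close> is the falling factorial n(n-1)...(n-k+1), the
  coefficient of the \<open>k\<close>-th derivative of x^n. It is 0 for k > n, so truncated
  subtraction does no damage.\<close>

lemma fact_choose_Suc: "fact (Suc k) * (n choose Suc k) = fact k * (n choose k) * (n - k)"
proof -
  have "Suc k * (n choose Suc k) = (n - k) * (n choose k)"
    by (simp only: binomial_absorption binomial_absorb_comp)
  moreover have "fact (Suc k) * (n choose Suc k) = fact k * (Suc k * (n choose Suc k))"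
    by (simp only: fact_Suc of_nat_id mult_ac)
  ultimately show ?thesis by (simp only: mult_ac)
qed

lemma partial_iter_poly:
  "(partial i ^^ m) (\<lambda>x. \<Sum>k\<in>G. c k * mpow (cvec x) (e k)) =
     (\<lambda>x. \<Sum>k\<in>G. c k * of_nat (fact m * (e k i choose m)) * mpow (cvec x) ((e k)(i := e k i - m)))"
proof (induction m)
  case (Suc m)
  have "(partial i ^^ Suc m) (\<lambda>x. \<Sum>k\<in>G. c k * mpow (cvec x) (e k)) =
      (\<lambda>x. \<Sum>k\<in>G. c k * of_nat (fact m * (e k i choose m)) * of_nat (e k i - m) *
        mpow (cvec x) ((e k)(i := e k i - m - 1)))"
    using partial_poly[where i = i and G = G and c = "\<lambda>k. c k * of_nat (fact m * (e k i choose m))" and e = "\<lambda>k. (e k)(i := e k i - m)"]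
    by (simp only: Suc funpow.simps o_apply fun_upd_same fun_upd_upd)
  also have "\<dots> = (\<lambda>x. \<Sum>k\<in>G. c k * of_nat (fact (Suc m) * (e k i choose Suc m)) *
        mpow (cvec x) ((e k)(i := e k i - Suc m)))"
    unfolding fact_choose_Suc of_nat_mult by (simp add: mult.assoc)
  finally show ?case .
qed simp

text \<open>Distinctness ensures that each coordinate still carries its original exponent when its
  turn comes.\<close>

lemma foldr_partial_poly:
  assumes "distinct is"
  shows "foldr (\<lambda>i g. (partial i ^^ \<alpha> i) g) is (\<lambda>x. \<Sum>k\<in>G. c k * mpow (cvec x) (e k)) =
    (\<lambda>x. \<Sum>k\<in>G. c k * of_nat (\<Prod>i\<in>set is. fact (\<alpha> i) * (e k i choose \<alpha> i)) *
       mpow (cvec x) (\<lambda>i. if i \<in> set is then e k i - \<alpha> i else e k i))"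
  using assms
proof (induction "is")
  case (Cons i "is")
  define e' where "e' k = (\<lambda>j. if j \<in> set is then e k j - \<alpha> j else e k j)" for k
  define c' where "c' k = c k * of_nat (\<Prod>j\<in>set is. fact (\<alpha> j) * (e k j choose \<alpha> j))" for k
  have "foldr (\<lambda>i g. (partial i ^^ \<alpha> i) g) (i # is) (\<lambda>x. \<Sum>k\<in>G. c k * mpow (cvec x) (e k)) =
      (partial i ^^ \<alpha> i) (\<lambda>x. \<Sum>k\<in>G. c' k * mpow (cvec x) (e' k))"
    using Cons by (simp add: c'_def e'_def)
  also have "\<dots> = (\<lambda>x. \<Sum>k\<in>G. c' k * of_nat (fact (\<alpha> i) * (e' k i choose \<alpha> i)) *
      mpow (cvec x) ((e' k)(i := e' k i - \<alpha> i)))"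
    by (rule partial_iter_poly)
  finally have "foldr (\<lambda>i g. (partial i ^^ \<alpha> i) g) (i # is) (\<lambda>x. \<Sum>k\<in>G. c k * mpow (cvec x) (e k)) = \<dots>" .
  moreover have "(e' k)(i := e' k i - \<alpha> i) = (\<lambda>j. if j \<in> set (i # is) then e k j - \<alpha> j else e k j)" for k
    using Cons.prems by (auto simp: e'_def)
  moreover have "c' k * of_nat (fact (\<alpha> i) * (e' k i choose \<alpha> i)) =
      c k * of_nat (\<Prod>j\<in>set (i # is). fact (\<alpha> j) * (e k j choose \<alpha> j))" for k
    using Cons.prems by (simp add: c'_def e'_def mult_ac)
  ultimately show ?case by (simp only:)
qed simp

text \<open>The coefficient \<gamma>! / (\<gamma> - \<alpha>)! of the derivative of order \<alpha>
  of x^\<gamma>, written so that it is 0 unless \<alpha> \<le> \<gamma>.\<close>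

definition falling :: "('n::finite \<Rightarrow> nat) \<Rightarrow> ('n \<Rightarrow> nat) \<Rightarrow> nat" where
  "falling \<gamma> \<alpha> = (\<Prod>i\<in>UNIV. fact (\<alpha> i) * (\<gamma> i choose \<alpha> i))"

lemma falling_eq_0: "\<alpha> \<notin> below \<gamma> \<Longrightarrow> falling \<gamma> \<alpha> = 0"
  by (auto simp: falling_def below_def not_le)

lemma falling_mfact:
  assumes "\<alpha> \<in> below \<gamma>"
  shows "falling \<gamma> \<alpha> * mfact (\<lambda>i. \<gamma> i - \<alpha> i) = mfact \<gamma>"
  unfolding falling_def mfact_def prod.distrib[symmetric]
proof (rule prod.cong)
  show "fact (\<alpha> i) * (\<gamma> i choose \<alpha> i) * fact (\<gamma> i - \<alpha> i) = fact (\<gamma> i)" for i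
    using binomial_fact_lemma[of "\<alpha> i" "\<gamma> i"] assms by (simp add: below_def mult_ac)
qed simp

lemma mfact_pos: "mfact \<alpha> > 0"
  by (simp add: mfact_def prod_pos)

text \<open>The order of differentiation picked by \<open>SOME\<close> disappears, because the
  formula depends only on the set of coordinates.\<close>

lemma partials_poly:
  "partials \<alpha> (\<lambda>x. \<Sum>k\<in>G. c k * mpow (cvec x) (e k)) =
    (\<lambda>x. \<Sum>k\<in>G. c k * of_nat (falling (e k) \<alpha>) * mpow (cvec x) (\<lambda>i. e k i - \<alpha> i))"
proof -
  define L where "L = (SOME is :: 'a list. distinct is \<and> set is = UNIV)"
  have "\<exists>is :: 'a list. distinct is \<and> set is = UNIV"
    using finite_distinct_list[OF finite, of "UNIV :: 'a set"] by auto
  then have "distinct L \<and> set L = UNIV" unfolding L_def by (rule someI_ex)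
  then show ?thesis
    unfolding partials_def L_def[symmetric] by (simp add: foldr_partial_poly falling_def)
qed

lemma diff_op_poly:
  assumes f: "has_taylor f a" and G: "finite G"
  shows "diff_op f (\<lambda>x. \<Sum>k\<in>G. c k * mpow (cvec x) (e k)) x =
    (\<Sum>k\<in>G. c k * (\<Sum>\<alpha>\<in>below (e k). a \<alpha> * of_nat (falling (e k) \<alpha>) * mpow (cvec x) (\<lambda>i. e k i - \<alpha> i)))"
proof -
  define t where "t k \<alpha> = a \<alpha> * of_nat (falling (e k) \<alpha>) * mpow (cvec x) (\<lambda>i. e k i - \<alpha> i)" for k \<alpha>
  \<comment> \<open>A finite set of exponents outside which every \<open>falling\<close> factor
    vanishes, so the infinite sum becomes a finite one.\<close>
  define A where "A = (\<Union>k\<in>G. below (e k))"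
  have A: "finite A" using G by (auto simp: A_def finite_below)
  have "diff_op f (\<lambda>x. \<Sum>k\<in>G. c k * mpow (cvec x) (e k)) x = (\<Sum>\<^sub>\<infinity>\<alpha>. \<Sum>k\<in>G. c k * t k \<alpha>)"
    by (simp add: diff_op_def partials_poly taylor_coeff_eq[OF f] sum_distrib_left t_def mult_ac)
  also have "\<dots> = (\<Sum>\<^sub>\<infinity>\<alpha>\<in>A. \<Sum>k\<in>G. c k * t k \<alpha>)"
    by (rule infsum_cong_neutral) (auto simp: A_def t_def falling_eq_0 intro!: sum.neutral)
  also have "\<dots> = (\<Sum>k\<in>G. c k * (\<Sum>\<alpha>\<in>A. t k \<alpha>))"
    using A by (simp add: sum_distrib_left) (rule sum.swap)
  also have "\<dots> = (\<Sum>k\<in>G. c k * (\<Sum>\<alpha>\<in>below (e k). t k \<alpha>))"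
    using A by (intro sum.cong refl arg_cong2[where f = "(*)"] sum.mono_neutral_right)
      (auto simp: A_def t_def falling_eq_0)
  finally show ?thesis by (simp add: t_def)
qed

section \<open>Polynomial functions as sums of monomials\<close>

definition list_poly :: "(complex \<times> ('n \<Rightarrow> nat)) list \<Rightarrow> real ^ 'n \<Rightarrow> complex" where
  "list_poly L x = (\<Sum>(c, \<gamma>)\<leftarrow>L. c * mpow (cvec x) \<gamma>)"

lemma list_poly_simps [simp]:
  "list_poly [] x = 0"
  "list_poly ((c, \<gamma>) # L) x = c * mpow (cvec x) \<gamma> + list_poly L x"
  "list_poly (L @ L') x = list_poly L x + list_poly L' x"
  by (simp_all add: list_poly_def)

lemma list_poly_mult_monomial:
  "list_poly (map (\<lambda>(d, \<delta>). (c * d, \<lambda>i. \<gamma> i + \<delta> i)) L) x = c * mpow (cvec x) \<gamma> * list_poly L x"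
  by (induction L) (auto simp: algebra_simps mpow_def power_add prod.distrib)

text \<open>Lists may repeat exponents, so sums are concatenations and a product distributes
  monomial by monomial.\<close>

lemma list_poly_mult: "\<exists>L''. \<forall>x. list_poly L'' x = list_poly L x * list_poly L' x"
proof (induction L)
  case Nil
  show ?case by (intro exI[of _ "[]"]) simp
next
  case (Cons p L)
  obtain c \<gamma> where p: "p = (c, \<gamma>)" by (cases p)
  obtain L1 where "\<And>x. list_poly L1 x = list_poly L x * list_poly L' x" using Cons by blast
  then show ?case
    by (intro exI[of _ "map (\<lambda>(d, \<delta>). (c * d, \<lambda>i. \<gamma> i + \<delta> i)) L' @ L1"])
       (simp add: p list_poly_mult_monomial distrib_right)
qed

lemma list_poly_sum:
  assumes "finite I" "\<And>i. i \<in> I \<Longrightarrow> \<exists>L. \<forall>x. list_poly L x = f i x"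
  shows "\<exists>L. \<forall>x. list_poly L x = (\<Sum>i\<in>I. f i x)"
  using assms
proof (induction I rule: finite_induct)
  case empty
  show ?case by (intro exI[of _ "[]"]) simp
next
  case (insert i I)
  then obtain L1 L2 where "\<And>x. list_poly L1 x = f i x" "\<And>x. list_poly L2 x = (\<Sum>i\<in>I. f i x)"
    by (metis insertCI)
  then show ?case using insert.hyps by (intro exI[of _ "L1 @ L2"]) simp
qed

text \<open>Induction over the generation of polynomial functions from linear forms and constants; a
  linear form is expanded in the standard basis.\<close>

lemma real_polynomial_function_list_poly:
  assumes "real_polynomial_function (p :: real ^ 'n \<Rightarrow> real)"
  shows "\<exists>L. \<forall>x. list_poly L x = complex_of_real (p x)"
  using assms
proof induction
  case (linear f)
  have "mpow (cvec x) (\<lambda>j. if j = i then 1 else 0) = complex_of_real (x $ i)" for x :: "real ^ 'n" and i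
    unfolding mpow_def by (simp add: if_distrib[of "power _"] cvec_def cong: if_cong)
  then have coord: "\<exists>L. \<forall>x. list_poly L x = complex_of_real (x $ i * f (axis i 1))" for i
    by (intro exI[of _ "[(complex_of_real (f (axis i 1)), \<lambda>j. if j = i then 1 else 0)]"]) simp
  have f_eq: "f x = (\<Sum>i\<in>UNIV. x $ i * f (axis i 1))" for x
  proof -
    have "f x = f (\<Sum>i\<in>UNIV. x $ i *\<^sub>R axis i 1)" using basis_expansion[of x] by (simp add: scalar_mult_eq_scaleR)
    also have "\<dots> = (\<Sum>i\<in>UNIV. x $ i * f (axis i 1))"
      using linear by (simp add: linear_sum bounded_linear.linear linear_cmul)
    finally show ?thesis .
  qed
  have "\<exists>L. \<forall>x. list_poly L x = (\<Sum>i\<in>UNIV. complex_of_real (x $ i * f (axis i 1)))"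
    by (rule list_poly_sum[OF _ coord]) simp
  then show ?case by (subst f_eq) simp
next
  case (const c)
  show ?case by (intro exI[of _ "[(complex_of_real c, \<lambda>_. 0)]"]) (simp add: mpow_def)
next
  case (add f g)
  then obtain L L' where "\<And>x. list_poly L x = f x" "\<And>x. list_poly L' x = g x" by blast
  then show ?case by (intro exI[of _ "L @ L'"]) simp
next
  case (mult f g)
  then show ?case using list_poly_mult by (metis of_real_mult)
qed

lemma polynomial_function_eq_monomials:
  fixes h :: "real ^ 'n \<Rightarrow> complex"
  assumes "polynomial_function h"
  shows "\<exists>(N::nat) c e. h = (\<lambda>x. \<Sum>k<N. c k * mpow (cvec x) (e k))"
proof -
  have "real_polynomial_function (Re \<circ> h)" "real_polynomial_function (Im \<circ> h)"
    using assms bounded_linear_Re bounded_linear_Im by (auto simp: polynomial_function_def)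
  then obtain L1 L2 where L: "\<And>x. list_poly L1 x = complex_of_real (Re (h x))"
      "\<And>x. list_poly L2 x = complex_of_real (Im (h x))"
    using real_polynomial_function_list_poly by (metis comp_apply)
  \<comment> \<open>The imaginary part is multiplied by the constant polynomial
    \<open>\<i>\<close>.\<close>
  obtain L3 where L3: "\<And>x. list_poly L3 x = list_poly [(\<i>, \<lambda>_. 0)] x * list_poly L2 x"
    using list_poly_mult by blast
  define K where "K = L1 @ L3"
  have "h x = list_poly K x" for x
    using complex_eq[of "h x"] by (simp add: K_def L L3 mpow_def)
  also have "list_poly K x = (\<Sum>k<length K. fst (K ! k) * mpow (cvec x) (snd (K ! k)))" for x
    unfolding list_poly_def by (simp add: sum_list_sum_nth split_beta atLeast0LessThan)
  finally show ?thesis by (intro exI) (rule ext)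
qed

subsection \<open>Entire functions and exponential sums\<close>

lemma entire_in_mero:
  fixes f :: "complex ^ 'n \<Rightarrow> complex"
  assumes "\<And>z. holo_at UNIV f z"
  shows "f \<in> mero UNIV"
proof -
  have one: "holo_at UNIV (\<lambda>_. 1) z" for z :: "complex ^ 'n"
    unfolding holo_at_def by (intro exI[of _ 1]) (auto intro!: exI[of _ "\<lambda>_. 0"])
  have "\<exists>r>0. \<exists>g h. (\<forall>w\<in>UNIV \<inter> ball z r. holo_at UNIV g w \<and> holo_at UNIV h w) \<and>
      (\<exists>w\<in>UNIV \<inter> ball z r. h w \<noteq> 0) \<and> (\<forall>w\<in>UNIV \<inter> ball z r. h w \<noteq> 0 \<longrightarrow> f w = g w / h w)" for z
    by (rule exI[of _ 1], rule conjI[OF zero_less_one], rule exI[of _ f], rule exI[of _ "\<lambda>_. 1"])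
       (use assms one in \<open>auto intro: exI[of _ z]\<close>)
  then have "locally_quotient UNIV f" by (simp add: locally_quotient_def)
  then show ?thesis using assms by (simp add: mero_def)
qed

lemma holo_at_sum_exp:
  assumes "finite X"
  shows "holo_at UNIV (\<lambda>\<xi> :: complex ^ 'n. \<Sum>x\<in>X. exp (pair \<xi> (f x))) z"
proof -
  have "\<exists>f'. ((\<lambda>\<xi>. \<Sum>x\<in>X. exp (pair \<xi> (f x))) has_derivative f') (at w) \<and> (\<forall>c v. f' (c *s v) = c * f' v)" for w
  proof (intro exI conjI allI)
    have pair: "((\<lambda>\<xi>. pair \<xi> x) has_derivative (\<lambda>\<eta>. pair \<eta> x)) (at w)" for x :: "complex ^ 'n"
    proof (rule bounded_linear_imp_has_derivative)
      show "bounded_linear (\<lambda>\<eta>. pair \<eta> x)"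
        unfolding pair_def by (intro bounded_linear_sum bounded_linear_mult_const bounded_linear_vec_nth)
    qed
    show "((\<lambda>\<xi>. \<Sum>x\<in>X. exp (pair \<xi> (f x))) has_derivative (\<lambda>\<eta>. \<Sum>x\<in>X. exp (pair w (f x)) * pair \<eta> (f x))) (at w)"
      using has_derivative_compose[OF pair, of exp]
      by (intro has_derivative_sum) (auto intro!: DERIV_exp[unfolded has_field_derivative_def])
    show "(\<Sum>x\<in>X. exp (pair w (f x)) * pair (c *s v) (f x)) = c * (\<Sum>x\<in>X. exp (pair w (f x)) * pair v (f x))" for c v
      by (simp add: pair_scale_left sum_distrib_left mult_ac)
  qed
  then show ?thesis unfolding holo_at_def by (intro exI[of _ 1]) auto
qed

section \<open>Exponential sums and integrals over bounded sets in V itself\<close>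

lemma quot_cdual_mat_1: "quot_cdual (mat 1 :: rat ^ 'n ^ 'n) = UNIV"
proof -
  have "quot_dual (mat 1 :: rat ^ 'n ^ 'n) {0} = UNIV"
    by (auto simp: quot_dual_def pair_def)
  moreover have "z \<in> vec.span (range emb)" for z :: "complex ^ 'n"
  proof -
    have "axis i 1 = (emb (axis i 1) :: complex ^ 'n)" for i
      by (auto simp: emb_def axis_def vec_eq_iff)
    then have "axis i 1 \<in> range (emb :: rat ^ 'n \<Rightarrow> complex ^ 'n)" for i by (metis rangeI)
    then have "(\<Sum>i\<in>UNIV. z $ i *s axis i 1) \<in> vec.span (range (emb :: rat ^ 'n \<Rightarrow> complex ^ 'n))"
      by (intro vec.span_sum vec.span_scale vec.span_base)
    then show ?thesis by (simp add: basis_expansion)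
  qed
  ultimately show ?thesis by (auto simp: quot_cdual_def complexify_def)
qed

lemma quot_pair_mat_1: "quot_pair (mat 1) \<xi> y = pair \<xi> y" for \<xi> y :: "complex ^ 'n"
proof -
  have "emb_mat (mat 1 :: rat ^ 'n ^ 'n) = (mat 1 :: complex ^ 'n ^ 'n)"
    by (auto simp: emb_mat_def mat_def vec_eq_iff)
  then show ?thesis by (simp add: quot_pair_def)
qed

text \<open>A finite sum converges at every \<xi>, so the defining condition prescribes all values;
  existence holds because the sum is entire.\<close>

lemma exp_sum_bounded:
  assumes "bounded_rat F"
  shows "exp_sum (mat 1) F = (\<lambda>\<xi>. \<Sum>x\<in>F \<inter> int_lattice. exp (pair \<xi> (emb x)))"
proof -
  have fin: "finite (F \<inter> int_lattice)" using assms by (rule finite_bounded_int_lattice)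
  show ?thesis
    unfolding exp_sum_def quot_cdual_mat_1 quot_pair_mat_1 quot_lattice_mat_1
    using bounded_not_contains_line[OF assms] fin entire_in_mero[OF holo_at_sum_exp[OF fin]]
    by (intro the_equality) auto
qed

text \<open>As for finite sums: the integrand is continuous on a compact set of finite measure,
  hence integrable for every \<xi>.\<close>

lemma exp_integral_bounded:
  assumes "bounded_rat P"
  shows "exp_integral (mat 1) P =
    (\<lambda>\<xi>. LINT x:real_hull P|aff_measure (mat 1) P. exp (pair \<xi> (cvec x)))"
proof -
  note M = sets_aff_measure[of "mat 1" P] compact_real_hull[OF assms]
    emeasure_aff_measure_compact[OF compact_real_hull[OF assms], of P]
  show ?thesis
    unfolding exp_integral_def quot_cdual_mat_1 quot_pair_mat_1
    using bounded_not_contains_line[OF assms] entire_in_mero[OF holo_at_set_integral_exp[OF M]]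
      set_integrable_exp_pair[OF M]
    by (intro the_equality) auto
qed

lemma eq_on_open_if_eq_on_dense:
  fixes f g :: "'a::metric_space \<Rightarrow> 'b::t2_space"
  assumes "open U" "continuous_on U f" "continuous_on U g" "closure D = UNIV"
    and eq: "\<And>z. z \<in> D \<Longrightarrow> f z = g z" and z: "z \<in> U"
  shows "f z = g z"
proof -
  \<comment> \<open>\<open>D\<close> stays dense inside the open set \<open>U\<close>, so a sequence
    can be chosen on which both continuity and the equality are available.\<close>
  have "z \<in> closure (U \<inter> D)"
    using open_Int_closure_subset[OF assms(1), of D] assms(4) z by auto
  then obtain s where s: "\<And>n. s n \<in> U \<inter> D" "s \<longlonglongrightarrow> z"
    by (auto simp: closure_sequential)
  have "(\<lambda>n. f (s n)) \<longlonglongrightarrow> f z" "(\<lambda>n. g (s n)) \<longlonglongrightarrow> g z"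
    using assms(1,2,3) s z by (auto intro!: continuous_on_tendsto_compose[of U])
  moreover have "f (s n) = g (s n)" for n using s(1) eq by auto
  ultimately show ?thesis using LIMSEQ_unique by simp
qed

lemma cvec_emb: "cvec (emb x) = emb x"
proof -
  have "complex_of_real (of_rat q) = of_rat q" for q
    by (cases q) (simp add: of_rat_rat)
  then show ?thesis by (simp add: cvec_def emb_def)
qed

text \<open>The coefficient of \<open>\<xi>\<^sup>\<gamma>\<close> in \<open>I(P) = \<Sum>\<^sub>F \<lambda>(Supp(P,F)) S(F)\<close>, times \<open>\<gamma>!\<close>.\<close>

lemma integral_mpow_eq:
  fixes P :: "(rat ^ 'n::finite) set"
  assumes bounded: "bounded_rat P"
    and eq: "mero_eq UNIV (exp_integral (mat 1) P) (\<lambda>\<xi>. \<Sum>F\<in>\<F>. f F \<xi> * exp_sum (mat 1) F \<xi>)"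
    and sub: "\<And>F. F \<in> \<F> \<Longrightarrow> F \<subseteq> P"
    and f: "\<And>F. F \<in> \<F> \<Longrightarrow> has_taylor (f F) (a F)"
  shows "(LINT x:real_hull P|aff_measure (mat 1) P. mpow (cvec x) \<gamma>) =
    (\<Sum>F\<in>\<F>. \<Sum>x\<in>F \<inter> int_lattice.
       \<Sum>\<alpha>\<in>below \<gamma>. a F \<alpha> * of_nat (falling \<gamma> \<alpha>) * mpow (cvec (emb x)) (\<lambda>i. \<gamma> i - \<alpha> i))"
proof -
  let ?K = "real_hull P" and ?M = "aff_measure (mat 1) P"
  note M = sets_aff_measure[of "mat 1" P] compact_real_hull[OF bounded]
    emeasure_aff_measure_compact[OF compact_real_hull[OF bounded], of P]
  define I where "I \<xi> = (LINT x:?K|?M. exp (pair \<xi> (cvec x)))" for \<xi>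
  define J where "J \<xi> = (\<Sum>F\<in>\<F>. f F \<xi> * (\<Sum>x\<in>F \<inter> int_lattice. exp (pair \<xi> (emb x))))" for \<xi>
  \<comment> \<open>The Cauchy product of the series of \<open>f F\<close> with the exponential
    series of the lattice points of \<open>F\<close>.\<close>
  define b where "b \<gamma> = (\<Sum>F\<in>\<F>. \<Sum>\<alpha>\<in>below \<gamma>. a F \<alpha> *
      (\<Sum>x\<in>F \<inter> int_lattice. mpow (emb x) (\<lambda>i. \<gamma> i - \<alpha> i) / of_nat (mfact (\<lambda>i. \<gamma> i - \<alpha> i))))" for \<gamma>
  have I: "has_taylor I (\<lambda>\<gamma>. (LINT x:?K|?M. mpow (cvec x) \<gamma>) / of_nat (mfact \<gamma>))"
    unfolding I_def[abs_def] by (rule has_taylor_set_integral_exp[OF M])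
  have J: "has_taylor J b"
    unfolding J_def[abs_def] b_def[abs_def]
    by (intro has_taylor_sum has_taylor_mult f has_taylor_exp_pair)
  obtain r s where rs: "r > 0" "s > 0" "continuous_on (polydisc r) I" "continuous_on (polydisc s) J"
    using has_taylor_continuous[OF I] has_taylor_continuous[OF J] by blast
  have "exp_sum (mat 1) F = (\<lambda>\<xi>. \<Sum>x\<in>F \<inter> int_lattice. exp (pair \<xi> (emb x)))" if "F \<in> \<F>" for F
    using bounded_rat_subset[OF bounded sub[OF that]] by (rule exp_sum_bounded)
  then have "mero_eq UNIV I J"
    using eq unfolding exp_integral_bounded[OF bounded] I_def[abs_def] J_def[abs_def] by simp
  then obtain D where D: "closure D = UNIV" "\<And>z. z \<in> D \<Longrightarrow> I z = J z"
    unfolding mero_eq_def by blast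
  \<comment> \<open>Agreement on a dense set extends to the polydisc where both sides are
    continuous, which is what comparing Taylor coefficients requires.\<close>
  have "I \<xi> = J \<xi>" if "\<forall>i. norm (\<xi> $ i) < min r s" for \<xi>
  proof (rule eq_on_open_if_eq_on_dense[OF open_polydisc _ _ D])
    show "continuous_on (polydisc (min r s)) I" "continuous_on (polydisc (min r s)) J"
      using rs(3,4) by (auto intro: continuous_on_subset simp: polydisc_def)
    show "\<xi> \<in> polydisc (min r s)" using that by (simp add: polydisc_def)
  qed
  then have "has_taylor J (\<lambda>\<gamma>. (LINT x:?K|?M. mpow (cvec x) \<gamma>) / of_nat (mfact \<gamma>))"
    using rs(1,2) by (intro has_taylor_cong[OF I, of "min r s"]) auto
  then have "(\<lambda>\<gamma>. (LINT x:?K|?M. mpow (cvec x) \<gamma>) / of_nat (mfact \<gamma>)) = b"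
    using J by (rule has_taylor_unique)
  then have "(LINT x:?K|?M. mpow (cvec x) \<gamma>) / of_nat (mfact \<gamma>) = b \<gamma>" by (rule fun_cong)
  then have "(LINT x:?K|?M. mpow (cvec x) \<gamma>) = b \<gamma> * of_nat (mfact \<gamma>)"
    using mfact_pos[of \<gamma>] by (simp add: field_simps)
  also have "\<dots> = (\<Sum>F\<in>\<F>. \<Sum>\<alpha>\<in>below \<gamma>. \<Sum>x\<in>F \<inter> int_lattice. a F \<alpha> *
      (mpow (emb x) (\<lambda>i. \<gamma> i - \<alpha> i) / of_nat (mfact (\<lambda>i. \<gamma> i - \<alpha> i))) * of_nat (mfact \<gamma>))"
    by (simp only: b_def sum_distrib_left sum_distrib_right)
  also have "\<dots> = (\<Sum>F\<in>\<F>. \<Sum>\<alpha>\<in>below \<gamma>. \<Sum>x\<in>F \<inter> int_lattice.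
      a F \<alpha> * of_nat (falling \<gamma> \<alpha>) * mpow (cvec (emb x)) (\<lambda>i. \<gamma> i - \<alpha> i))"
  \<comment> \<open>Here \<gamma>! cancels (\<gamma> - \<alpha>)! and leaves the falling
    factorial.\<close>
  proof (intro sum.cong refl)
    fix F \<alpha> x assume "\<alpha> \<in> below \<gamma>"
    then have "of_nat (mfact \<gamma>) = (of_nat (falling \<gamma> \<alpha>) * of_nat (mfact (\<lambda>i. \<gamma> i - \<alpha> i)) :: complex)"
      using falling_mfact[of \<alpha> \<gamma>] by (simp flip: of_nat_mult)
    then show "a F \<alpha> * (mpow (emb x) (\<lambda>i. \<gamma> i - \<alpha> i) / of_nat (mfact (\<lambda>i. \<gamma> i - \<alpha> i))) * of_nat (mfact \<gamma>)
        = a F \<alpha> * of_nat (falling \<gamma> \<alpha>) * mpow (cvec (emb x)) (\<lambda>i. \<gamma> i - \<alpha> i)"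
      using mfact_pos[of "\<lambda>i. \<gamma> i - \<alpha> i"] by (simp add: cvec_emb)
  qed
  also have "\<dots> = (\<Sum>F\<in>\<F>. \<Sum>x\<in>F \<inter> int_lattice. \<Sum>\<alpha>\<in>below \<gamma>.
      a F \<alpha> * of_nat (falling \<gamma> \<alpha>) * mpow (cvec (emb x)) (\<lambda>i. \<gamma> i - \<alpha> i))"
    by (intro sum.cong refl sum.swap)
  finally show ?thesis .
qed

theorem theorem6:
  fixes \<Psi> :: "'n::finite compl_map"
    and lam :: "(rat ^ 'n) set \<Rightarrow> complex ^ 'n \<Rightarrow> complex"
    and P :: "(rat ^ 'n) set"
  assumes rigid: "rigid_complement_map \<Psi>"
    and interpolator: "IS_interpolator \<Psi> lam"
    and analytic: "\<And>K. lattice_cone (mat 1) K \<Longrightarrow> generic_cone (mat 1) \<Psi> K \<Longrightarrow> analytic_at_0 (lam K)"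
    and polytope: "lattice_polytope (mat 1) P"
    and generic: "generic_polyhedron (mat 1) \<Psi> P"
  shows "(\<forall>h :: real ^ 'n \<Rightarrow> complex. polynomial_function h \<longrightarrow>
            (LINT x:real_hull P|aff_measure (mat 1) P. h x) =
              (\<Sum>F\<in>faces P. \<Sum>x\<in>F \<inter> int_lattice. diff_op (lam (supp_cone P F)) h (emb x))) \<and>
         complex_of_real (vol P) =
              (\<Sum>F\<in>faces P. lam (supp_cone P F) 0 * of_nat (card (F \<inter> int_lattice)))"
proof -
  let ?K = "real_hull P" and ?M = "aff_measure (mat 1) P"
  have bounded: "bounded_rat P" and lattice: "lattice_polyhedron (mat 1) P"
    using polytope by (auto simp: lattice_polytope_def)
  note M = sets_aff_measure[of "mat 1" P] compact_real_hull[OF bounded]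
    emeasure_aff_measure_compact[OF compact_real_hull[OF bounded], of P]
  \<comment> \<open>Analyticity is assumed for generic lattice cones: genericity of the supporting
    cones is part of \<open>generic_polyhedron\<close>, and the lattice property comes from the
    lattice points in minimal faces.\<close>
  have "\<forall>F\<in>faces P. \<exists>a. has_taylor (lam (supp_cone P F)) a"
    using analytic lattice_cone_supp_cone[OF lattice] generic
    unfolding analytic_at_0_def generic_polyhedron_def by blast
  then obtain a where a: "\<And>F. F \<in> faces P \<Longrightarrow> has_taylor (lam (supp_cone P F)) (a F)" by metis
  have "mero_eq UNIV (exp_integral (mat 1) P) (\<lambda>\<xi>. \<Sum>F\<in>faces P. lam (supp_cone P F) \<xi> * exp_sum (mat 1) F \<xi>)"
    using interpolator lattice generic
    unfolding IS_interpolator_def IS_identity_def quot_cdual_mat_1 by blast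
  then have monomial: "(LINT x:?K|?M. mpow (cvec x) \<gamma>) =
      (\<Sum>F\<in>faces P. \<Sum>x\<in>F \<inter> int_lattice. \<Sum>\<alpha>\<in>below \<gamma>.
         a F \<alpha> * of_nat (falling \<gamma> \<alpha>) * mpow (cvec (emb x)) (\<lambda>i. \<gamma> i - \<alpha> i))" for \<gamma>
    by (rule integral_mpow_eq[OF bounded _ _ a]) (auto simp: faces_def)
  have main: "(LINT x:?K|?M. h x) =
      (\<Sum>F\<in>faces P. \<Sum>x\<in>F \<inter> int_lattice. diff_op (lam (supp_cone P F)) h (emb x))"
    if h: "polynomial_function h" for h :: "real ^ 'n \<Rightarrow> complex"
  proof -
    obtain N :: nat and c e where h_eq: "h = (\<lambda>x. \<Sum>k<N. c k * mpow (cvec x) (e k))"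
      using polynomial_function_eq_monomials[OF h] by blast
    define D where "D F x k = (\<Sum>\<alpha>\<in>below (e k). a F \<alpha> * of_nat (falling (e k) \<alpha>) *
        mpow (cvec (emb x)) (\<lambda>i. e k i - \<alpha> i))" for F x k
    have "set_integrable ?M ?K (\<lambda>x. c k * mpow (cvec x) (e k))" for k
      by (intro set_integrable_continuous[OF M] continuous_intros continuous_on_mpow_cvec)
    then have "(LINT x:?K|?M. h x) = (\<Sum>k<N. LINT x:?K|?M. c k * mpow (cvec x) (e k))"
      unfolding h_eq set_integrable_def set_lebesgue_integral_def scaleR_sum_right
      by (intro Bochner_Integration.integral_sum) auto
    also have "\<dots> = (\<Sum>k<N. \<Sum>F\<in>faces P. \<Sum>x\<in>F \<inter> int_lattice. c k * D F x k)"
      by (simp add: monomial D_def sum_distrib_left)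
    also have "\<dots> = (\<Sum>F\<in>faces P. \<Sum>k<N. \<Sum>x\<in>F \<inter> int_lattice. c k * D F x k)"
      by (rule sum.swap)
    also have "\<dots> = (\<Sum>F\<in>faces P. \<Sum>x\<in>F \<inter> int_lattice. \<Sum>k<N. c k * D F x k)"
      by (intro sum.cong refl sum.swap)
    also have "\<dots> = (\<Sum>F\<in>faces P. \<Sum>x\<in>F \<inter> int_lattice. diff_op (lam (supp_cone P F)) h (emb x))"
      unfolding h_eq D_def by (intro sum.cong refl diff_op_poly[OF a, symmetric]) auto
    finally show ?thesis .
  qed
  \<comment> \<open>The volume is the moment of exponent 0.\<close>
  have "complex_of_real (vol P) = (LINT x:?K|?M. mpow (cvec x) (\<lambda>_. 0))"
    by (simp add: vol_def mpow_def set_lebesgue_integral_def K_sets[OF M] scaleR_conv_of_real)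
  also have "\<dots> = (\<Sum>F\<in>faces P. lam (supp_cone P F) 0 * of_nat (card (F \<inter> int_lattice)))"
  proof -
    \<comment> \<open>Only \<alpha> = 0 remains, so the operator reduces to the constant Taylor
      coefficient, the value at 0, and the sum over lattice points counts them.\<close>
    have "below (\<lambda>_ :: 'n. 0) = {\<lambda>_. 0}" by (auto simp: below_def)
    then show ?thesis
      unfolding monomial by (auto intro!: sum.cong simp: falling_def mpow_def has_taylor_at_0[OF a])
  qed
  finally show ?thesis using main by blast
qed

end
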